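(* For a semigroup $S$ with zero, the following conditions are equivalent: (1) $S$ is abundant and is an I-order in some primitive inverse semigroup $Q$; (2) $S$ is a primitive adequate semigroup and $\lambda$ and $\rho$ are transitive; (3) $S$ is $0$-cancellative, categorical at $0$, for each $a\in S$ there are $e\in S$ with $ea=a$ and $f\in S$ with $af=a$, and $\lambda$ and $\rho$ are transitive.
   Context: On a semigroup $S$: $a\,\mathcal{R}^{*}\,b$ if and only if for all $x,y\in S^{1}$, $xa=ya\Leftrightarrow xb=yb$; $\mathcal{L}^{*}$ is defined dually. $S$ is abundant if each $\mathcal{R}^{*}$-class and each $\mathcal{L}^{*}$-class contains at least one idempotent; $S$ is adequate if it is abundant and its set of idempotents $E(S)$ is a semilattice (idempotents commute). A semigroup with zero is primitive if every nonzero idempotent $e$ is primitive, i.e. for every idempotent $f$, $f\le e$ (that is, $ef=fe=f$) implies $f=0$ or $f=e$; a primitive inverse semigroup is an inverse semigroup with zero which is primitive in this sense. A semigroup $S$ with zero is categorical at $0$ if $ab\neq 0$ and $bc\neq 0$ imply $abc\neq 0$; it is $0$-cancellative if $ab=ac\neq 0$ implies $b=c$, and $ba=ca\neq 0$ implies $b=c$. The relations $\lambda,\rho$ on $S$: $a\,\lambda\,b$ if and only if $a=b=0$ or $Sa\cap Sb\neq\{0\}$; $a\,\rho\,b$ if and only if $a=b=0$ or $aS\cap bS\neq\{0\}$. A subsemigroup $S$ of an inverse semigroup $Q$ is an I-order in $Q$ if every $q\in Q$ can be written as $a^{-1}b$ with $a,b\in S$ and also every $q\in Q$ can be written as $cd^{-1}$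 with $c,d\in S$, inverses being taken in $Q$. An abstract semigroup $S$ is said to be an I-order in $Q$ if it embeds in $Q$ as such a subsemigroup. *)

theory Defs
  imports "HOL-Algebra.Congruence"
begin

record 'a sgrp = "'a partial_object" +
  smult :: "['a, 'a] \<Rightarrow> 'a"  (infixl \<open>\<odot>\<index>\<close> 70)

locale sgrp =
  fixes S :: "('a, 'm) sgrp_scheme" (structure)
  assumes smult_closed: "x \<in> carrier S \<Longrightarrow> y \<in> carrier S \<Longrightarrow> x \<odot> y \<in> carrier S"
    and smult_assoc: "x \<in> carrier S \<Longrightarrow> y \<in> carrier S \<Longrightarrow> w \<in> carrier S
      \<Longrightarrow> (x \<odot> y) \<odot> w = x \<odot> (y \<odot> w)"

definition is_zero :: "('a, 'm) sgrp_scheme \<Rightarrow> 'a \<Rightarrow> bool" where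
  "is_zero S z \<longleftrightarrow> z \<in> carrier S \<and>
     (\<forall>x\<in>carrier S. z \<odot>\<^bsub>S\<^esub> x = z \<and> x \<odot>\<^bsub>S\<^esub> z = z)"

definition is_identity :: "('a, 'm) sgrp_scheme \<Rightarrow> 'a \<Rightarrow> bool" where
  "is_identity S u \<longleftrightarrow> u \<in> carrier S \<and>
     (\<forall>x\<in>carrier S. u \<odot>\<^bsub>S\<^esub> x = x \<and> x \<odot>\<^bsub>S\<^esub> u = x)"

definition idempotents :: "('a, 'm) sgrp_scheme \<Rightarrow> 'a set" where
  "idempotents S = {e \<in> carrier S. e \<odot>\<^bsub>S\<^esub> e = e}"

text \<open>The monoid \<open>S\<^sup>1\<close>: elements of \<open>S\<close> appear as \<^term>\<open>Some x\<close>, and an identity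
  \<^term>\<open>None\<close> is adjoined only if \<open>S\<close> has none.\<close>

definition with_one :: "('a, 'm) sgrp_scheme \<Rightarrow> 'a option sgrp" where
  "with_one S =
     \<lparr>carrier = (if \<exists>u. is_identity S u then Some ` carrier S
                 else insert None (Some ` carrier S)),
      smult = (\<lambda>x y. case x of None \<Rightarrow> y
                 | Some a \<Rightarrow> (case y of None \<Rightarrow> x | Some b \<Rightarrow> Some (a \<odot>\<^bsub>S\<^esub> b)))\<rparr>"

definition R_star :: "('a, 'm) sgrp_scheme \<Rightarrow> 'a \<Rightarrow> 'a \<Rightarrow> bool" where
  "R_star S a b \<longleftrightarrow>
     (\<forall>x\<in>carrier (with_one S). \<forall>y\<in>carrier (with_one S).
        x \<odot>\<^bsub>with_one S\<^esub> Some a = y \<odot>\<^bsub>with_one S\<^esub> Some a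
        \<longleftrightarrow> x \<odot>\<^bsub>with_one S\<^esub> Some b = y \<odot>\<^bsub>with_one S\<^esub> Some b)"

definition L_star :: "('a, 'm) sgrp_scheme \<Rightarrow> 'a \<Rightarrow> 'a \<Rightarrow> bool" where
  "L_star S a b \<longleftrightarrow>
     (\<forall>x\<in>carrier (with_one S). \<forall>y\<in>carrier (with_one S).
        Some a \<odot>\<^bsub>with_one S\<^esub> x = Some a \<odot>\<^bsub>with_one S\<^esub> y
        \<longleftrightarrow> Some b \<odot>\<^bsub>with_one S\<^esub> x = Some b \<odot>\<^bsub>with_one S\<^esub> y)"

definition abundant :: "('a, 'm) sgrp_scheme \<Rightarrow> bool" where
  "abundant S \<longleftrightarrow>
     (\<forall>a\<in>carrier S. \<exists>e\<in>idempotents S. R_star S a e) \<and>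
     (\<forall>a\<in>carrier S. \<exists>e\<in>idempotents S. L_star S a e)"

definition adequate :: "('a, 'm) sgrp_scheme \<Rightarrow> bool" where
  "adequate S \<longleftrightarrow> abundant S \<and>
     (\<forall>e\<in>idempotents S. \<forall>f\<in>idempotents S. e \<odot>\<^bsub>S\<^esub> f = f \<odot>\<^bsub>S\<^esub> e)"

definition primitive :: "('a, 'm) sgrp_scheme \<Rightarrow> 'a \<Rightarrow> bool" where
  "primitive S z \<longleftrightarrow>
     (\<forall>e\<in>idempotents S. e \<noteq> z \<longrightarrow>
        (\<forall>f\<in>idempotents S. e \<odot>\<^bsub>S\<^esub> f = f \<and> f \<odot>\<^bsub>S\<^esub> e = f \<longrightarrow> f = z \<or> f = e))"

definition is_inverse :: "('a, 'm) sgrp_scheme \<Rightarrow> 'a \<Rightarrow> 'a \<Rightarrow> bool" where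
  "is_inverse Q a b \<longleftrightarrow> b \<in> carrier Q \<and>
     a \<odot>\<^bsub>Q\<^esub> b \<odot>\<^bsub>Q\<^esub> a = a \<and> b \<odot>\<^bsub>Q\<^esub> a \<odot>\<^bsub>Q\<^esub> b = b"

definition inverse_semigroup :: "('a, 'm) sgrp_scheme \<Rightarrow> bool" where
  "inverse_semigroup Q \<longleftrightarrow> sgrp Q \<and> (\<forall>a\<in>carrier Q. \<exists>!b. is_inverse Q a b)"

definition sinv :: "('a, 'm) sgrp_scheme \<Rightarrow> 'a \<Rightarrow> 'a" where
  "sinv Q a = (THE b. is_inverse Q a b)"

definition primitive_inverse_semigroup :: "('a, 'm) sgrp_scheme \<Rightarrow> bool" where
  "primitive_inverse_semigroup Q \<longleftrightarrow>
     inverse_semigroup Q \<and> (\<exists>z. is_zero Q z \<and> primitive Q z)"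

definition subsemigroup :: "'a set \<Rightarrow> ('a, 'm) sgrp_scheme \<Rightarrow> bool" where
  "subsemigroup T Q \<longleftrightarrow> T \<subseteq> carrier Q \<and> (\<forall>a\<in>T. \<forall>b\<in>T. a \<odot>\<^bsub>Q\<^esub> b \<in> T)"

definition sub_I_order :: "'a set \<Rightarrow> ('a, 'm) sgrp_scheme \<Rightarrow> bool" where
  "sub_I_order T Q \<longleftrightarrow> subsemigroup T Q \<and>
     (\<forall>q\<in>carrier Q. \<exists>a\<in>T. \<exists>b\<in>T. q = sinv Q a \<odot>\<^bsub>Q\<^esub> b) \<and>
     (\<forall>q\<in>carrier Q. \<exists>c\<in>T. \<exists>d\<in>T. q = c \<odot>\<^bsub>Q\<^esub> sinv Q d)"

definition sgrp_embedding ::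
  "('a, 'm) sgrp_scheme \<Rightarrow> ('b, 'n) sgrp_scheme \<Rightarrow> ('a \<Rightarrow> 'b) \<Rightarrow> bool" where
  "sgrp_embedding S Q \<phi> \<longleftrightarrow> \<phi> ` carrier S \<subseteq> carrier Q \<and> inj_on \<phi> (carrier S) \<and>
     (\<forall>a\<in>carrier S. \<forall>b\<in>carrier S. \<phi> (a \<odot>\<^bsub>S\<^esub> b) = \<phi> a \<odot>\<^bsub>Q\<^esub> \<phi> b)"

text \<open>The embedding is one of semigroups; it automatically maps a zero of \<open>S\<close> to the zero of \<open>Q\<close>.
  If \<open>S\<close> is an I-order in \<open>Q\<close>, then \<open>Q\<close> is the image of \<open>S \<times> S\<close> under
  \<open>(a, b) \<mapsto> a\<^sup>-\<^sup>1 b\<close>, so an isomorphic copy of \<open>Q\<close> has its carrier inside the type of pairs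
  of elements of \<open>S\<close>. Quantifying existentially over \<open>Q\<close> on that type therefore loses nothing.\<close>

definition I_order_in :: "('a, 'm) sgrp_scheme \<Rightarrow> ('b, 'n) sgrp_scheme \<Rightarrow> bool" where
  "I_order_in S Q \<longleftrightarrow> (\<exists>\<phi>. sgrp_embedding S Q \<phi> \<and> sub_I_order (\<phi> ` carrier S) Q)"

definition categorical_at :: "('a, 'm) sgrp_scheme \<Rightarrow> 'a \<Rightarrow> bool" where
  "categorical_at S z \<longleftrightarrow>
     (\<forall>a\<in>carrier S. \<forall>b\<in>carrier S. \<forall>c\<in>carrier S.
        a \<odot>\<^bsub>S\<^esub> b \<noteq> z \<and> b \<odot>\<^bsub>S\<^esub> c \<noteq> z \<longrightarrow> a \<odot>\<^bsub>S\<^esub> b \<odot>\<^bsub>S\<^esub> c \<noteq> z)"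

definition zero_cancellative :: "('a, 'm) sgrp_scheme \<Rightarrow> 'a \<Rightarrow> bool" where
  "zero_cancellative S z \<longleftrightarrow>
     (\<forall>a\<in>carrier S. \<forall>b\<in>carrier S. \<forall>c\<in>carrier S.
        (a \<odot>\<^bsub>S\<^esub> b = a \<odot>\<^bsub>S\<^esub> c \<and> a \<odot>\<^bsub>S\<^esub> c \<noteq> z \<longrightarrow> b = c) \<and>
        (b \<odot>\<^bsub>S\<^esub> a = c \<odot>\<^bsub>S\<^esub> a \<and> c \<odot>\<^bsub>S\<^esub> a \<noteq> z \<longrightarrow> b = c))"

definition lam :: "('a, 'm) sgrp_scheme \<Rightarrow> 'a \<Rightarrow> 'a \<Rightarrow> 'a \<Rightarrow> bool" where
  "lam S z a b \<longleftrightarrow> (a = z \<and> b = z) \<or>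
     (\<lambda>s. s \<odot>\<^bsub>S\<^esub> a) ` carrier S \<inter> (\<lambda>s. s \<odot>\<^bsub>S\<^esub> b) ` carrier S \<noteq> {z}"

definition rho :: "('a, 'm) sgrp_scheme \<Rightarrow> 'a \<Rightarrow> 'a \<Rightarrow> 'a \<Rightarrow> bool" where
  "rho S z a b \<longleftrightarrow> (a = z \<and> b = z) \<or>
     (\<lambda>s. a \<odot>\<^bsub>S\<^esub> s) ` carrier S \<inter> (\<lambda>s. b \<odot>\<^bsub>S\<^esub> s) ` carrier S \<noteq> {z}"

end

theory Submission
  imports Defs
begin

text \<open>Conditions (2) and (3) both say that the nonzero elements of \<open>S\<close> are the arrows of a
  cancellative category whose identities are the nonzero idempotents: the product of \<open>a\<close> and \<open>b\<close>
  is nonzero exactly if the right identity \<open>tgt a\<close> of \<open>a\<close> is the left identity \<open>src b\<close> of \<open>b\<close>.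
  Every \<open>a\<close> is \<open>\<lambda>\<close>-related to \<open>tgt a\<close>, so transitivity of \<open>\<lambda>\<close> is the left Ore condition and,
  dually, transitivity of \<open>\<rho>\<close> is the right Ore condition. Hence the category has a groupoid of
  fractions, and this groupoid with a zero adjoined is a primitive inverse semigroup in which \<open>S\<close>
  is an I-order. Conversely, in an I-order \<open>a \<lambda> b\<close> holds for nonzero \<open>a, b\<close> exactly if
  \<open>a\<^sup>-\<^sup>1 a = b\<^sup>-\<^sup>1 b\<close> in \<open>Q\<close>, which is a transitive relation.\<close>

section \<open>Opposite semigroups\<close>

text \<open>Reversing the product turns \<open>L_star\<close> into \<open>R_star\<close> and
  \<open>rho\<close> into \<open>lam\<close>, so that most dual statements need only one
  proof.\<close>

definition opp :: "('a, 'm) sgrp_scheme \<Rightarrow> 'a sgrp" where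
  "opp S = \<lparr>carrier = carrier S, smult = (\<lambda>x y. y \<odot>\<^bsub>S\<^esub> x)\<rparr>"

lemma opp_simps [simp]:
  "carrier (opp S) = carrier S"
  "x \<odot>\<^bsub>opp S\<^esub> y = y \<odot>\<^bsub>S\<^esub> x"
  by (simp_all add: opp_def)

lemma sgrp_opp: "sgrp S \<Longrightarrow> sgrp (opp S)"
  by (simp add: sgrp_def)

lemma is_zero_opp [simp]: "is_zero (opp S) z \<longleftrightarrow> is_zero S z"
  by (auto simp: is_zero_def)

lemma is_identity_opp [simp]: "is_identity (opp S) = is_identity S"
  by (auto simp: is_identity_def fun_eq_iff)

lemma idempotents_opp [simp]: "idempotents (opp S) = idempotents S"
  by (simp add: idempotents_def)

lemma carrier_with_one_opp: "carrier (with_one (opp S)) = carrier (with_one S)"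
  by (auto simp: with_one_def)

lemma smult_with_one_opp: "x \<odot>\<^bsub>with_one (opp S)\<^esub> y = y \<odot>\<^bsub>with_one S\<^esub> x"
  by (simp add: with_one_def split: option.split)

lemma R_star_opp [simp]: "R_star (opp S) = L_star S"
  by (simp add: R_star_def L_star_def carrier_with_one_opp smult_with_one_opp fun_eq_iff)

lemma L_star_opp [simp]: "L_star (opp S) = R_star S"
  by (simp add: R_star_def L_star_def carrier_with_one_opp smult_with_one_opp fun_eq_iff)

lemma abundant_opp [simp]: "abundant (opp S) \<longleftrightarrow> abundant S"
  by (auto simp: abundant_def)

lemma adequate_opp [simp]: "adequate (opp S) \<longleftrightarrow> adequate S"
  unfolding adequate_def by (simp, metis)

lemma primitive_opp [simp]: "primitive (opp S) z \<longleftrightarrow> primitive S z"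
  by (simp add: primitive_def conj_commute)

lemma lam_opp [simp]: "lam (opp S) z = rho S z"
  by (simp add: lam_def rho_def fun_eq_iff)

lemma zero_cancellative_opp: "zero_cancellative S z \<Longrightarrow> zero_cancellative (opp S) z"
  by (simp add: zero_cancellative_def)

lemma categorical_at_opp: "sgrp S \<Longrightarrow> categorical_at S z \<Longrightarrow> categorical_at (opp S) z"
  by (simp add: categorical_at_def sgrp.smult_assoc)

section \<open>The relations \<open>\<lambda>\<close> and \<open>\<R>\<^sup>*\<close>\<close>

text \<open>The zero is a left multiple of both elements, so the intersection in \<open>lam\<close>
  is never empty, and differing from \<open>{z}\<close> means containing a nonzero common left
  multiple.\<close>

lemma lam_iff:
  assumes "is_zero S z" "a \<in> carrier S" "b \<in> carrier S"
  shows "lam S z a b \<longleftrightarrow> (a = z \<and> b = z) \<or>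
    (\<exists>x\<in>carrier S. \<exists>y\<in>carrier S. x \<odot>\<^bsub>S\<^esub> a = y \<odot>\<^bsub>S\<^esub> b \<and> x \<odot>\<^bsub>S\<^esub> a \<noteq> z)"
proof -
  let ?I = "(\<lambda>s. s \<odot>\<^bsub>S\<^esub> a) ` carrier S \<inter> (\<lambda>s. s \<odot>\<^bsub>S\<^esub> b) ` carrier S"
  have "z \<odot>\<^bsub>S\<^esub> a = z" "z \<odot>\<^bsub>S\<^esub> b = z" "z \<in> carrier S"
    using assms by (auto simp: is_zero_def)
  then have "z \<in> ?I" by (metis IntI image_eqI)
  then have "?I \<noteq> {z} \<longleftrightarrow> (\<exists>w\<in>?I. w \<noteq> z)" by auto
  also have "\<dots> \<longleftrightarrow> (\<exists>x\<in>carrier S. \<exists>y\<in>carrier S. x \<odot>\<^bsub>S\<^esub> a = y \<odot>\<^bsub>S\<^esub> b \<and> x \<odot>\<^bsub>S\<^esub> a \<noteq> z)"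
    by (auto; metis)
  finally show ?thesis by (simp add: lam_def)
qed

text \<open>The first conclusion compares the multipliers \<open>e\<close> and \<open>1\<close> from
  the monoid with identity: they agree on \<open>e\<close>, hence on \<open>a\<close>. The second
  compares two multipliers from \<open>S\<close>.\<close>

lemma R_star_idempotentD:
  assumes "sgrp S" "a \<in> carrier S" "e \<in> idempotents S" "R_star S a e"
  shows "e \<odot>\<^bsub>S\<^esub> a = a"
    and "x \<in> carrier S \<Longrightarrow> y \<in> carrier S \<Longrightarrow> x \<odot>\<^bsub>S\<^esub> a = y \<odot>\<^bsub>S\<^esub> a \<Longrightarrow> x \<odot>\<^bsub>S\<^esub> e = y \<odot>\<^bsub>S\<^esub> e"
proof -
  have e: "e \<in> carrier S" "e \<odot>\<^bsub>S\<^esub> e = e" using assms(3) by (auto simp: idempotents_def)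
  have R: "Some x \<odot>\<^bsub>with_one S\<^esub> Some a = v \<odot>\<^bsub>with_one S\<^esub> Some a
      \<longleftrightarrow> Some x \<odot>\<^bsub>with_one S\<^esub> Some e = v \<odot>\<^bsub>with_one S\<^esub> Some e"
    if "x \<in> carrier S" "v \<in> carrier (with_one S)" for x v
    using assms(4) that unfolding R_star_def by (auto simp: with_one_def split: if_splits)
  show "x \<odot>\<^bsub>S\<^esub> e = y \<odot>\<^bsub>S\<^esub> e" if "x \<in> carrier S" "y \<in> carrier S" "x \<odot>\<^bsub>S\<^esub> a = y \<odot>\<^bsub>S\<^esub> a"
    using R[of x "Some y"] that by (simp add: with_one_def)
  show "e \<odot>\<^bsub>S\<^esub> a = a"
  \<comment> \<open>The role of \<open>1\<close> is played by \<open>None\<close> only if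
    \<open>S\<close> has no identity; otherwise an identity \<open>u\<close> of \<open>S\<close>
    plays it.\<close>
  proof (cases "\<exists>u. is_identity S u")
    case True
    then obtain u where u: "is_identity S u" ..
    then show ?thesis
      using R[of e "Some u"] e assms(2) True by (auto simp: with_one_def is_identity_def)
  next
    case False
    then show ?thesis using R[of e None] e by (simp add: with_one_def)
  qed
qed

text \<open>Multipliers from \<open>S\<close> suffice: since \<open>e a = a\<close> and
  \<open>e e = e\<close>, comparing \<open>x\<close> with an adjoined identity amounts to comparing
  \<open>x\<close> with \<open>e\<close>.\<close>

lemma R_star_idempotentI:
  assumes "sgrp S" "a \<in> carrier S" "e \<in> idempotents S" "e \<odot>\<^bsub>S\<^esub> a = a"
    and canc: "\<And>x y. x \<in> carrier S \<Longrightarrow> y \<in> carrier S \<Longrightarrow> x \<odot>\<^bsub>S\<^esub> a = y \<odot>\<^bsub>S\<^esub> a \<Longrightarrow>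
      x \<odot>\<^bsub>S\<^esub> e = y \<odot>\<^bsub>S\<^esub> e"
  shows "R_star S a e"
proof -
  interpret sgrp S by fact
  have e: "e \<in> carrier S" "e \<odot>\<^bsub>S\<^esub> e = e" using assms(3) by (auto simp: idempotents_def)
  have conv: "x \<odot>\<^bsub>S\<^esub> a = y \<odot>\<^bsub>S\<^esub> a"
    if "x \<in> carrier S" "y \<in> carrier S" "x \<odot>\<^bsub>S\<^esub> e = y \<odot>\<^bsub>S\<^esub> e" for x y
    using that assms(2,4) e smult_assoc by metis
  have iff: "x \<odot>\<^bsub>S\<^esub> a = y \<odot>\<^bsub>S\<^esub> a \<longleftrightarrow> x \<odot>\<^bsub>S\<^esub> e = y \<odot>\<^bsub>S\<^esub> e"
    if "x \<in> carrier S" "y \<in> carrier S" for x y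
    using that canc conv by blast
  have id: "x \<odot>\<^bsub>S\<^esub> a = a \<longleftrightarrow> x \<odot>\<^bsub>S\<^esub> e = e" if "x \<in> carrier S" for x
    using iff[OF that e(1)] assms(4) e by simp
  show ?thesis
    unfolding R_star_def
  proof (intro ballI)
    fix x y
    assume "x \<in> carrier (with_one S)" "y \<in> carrier (with_one S)"
    then have "x = None \<or> (\<exists>u\<in>carrier S. x = Some u)" "y = None \<or> (\<exists>v\<in>carrier S. y = Some v)"
      by (auto simp: with_one_def split: if_splits)
    then show "x \<odot>\<^bsub>with_one S\<^esub> Some a = y \<odot>\<^bsub>with_one S\<^esub> Some a \<longleftrightarrow>
        x \<odot>\<^bsub>with_one S\<^esub> Some e = y \<odot>\<^bsub>with_one S\<^esub> Some e"
      using iff id by (elim disjE bexE) (simp_all add: with_one_def, metis)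
  qed
qed

locale zero_sgrp = sgrp S for S :: "'a sgrp" (structure) +
  fixes z :: 'a
  assumes zero: "is_zero S z"
begin

lemma zero_simps [simp]:
  "z \<in> carrier S"
  "x \<in> carrier S \<Longrightarrow> z \<odot> x = z"
  "x \<in> carrier S \<Longrightarrow> x \<odot> z = z"
  using zero by (auto simp: is_zero_def)

declare smult_closed [simp]

lemma zero_sgrp_opp: "zero_sgrp (opp S) z"
  by (rule zero_sgrp.intro[OF sgrp_opp]) (unfold_locales, simp add: zero)

end

section \<open>Primitive adequate semigroups\<close>

locale primitive_adequate = zero_sgrp +
  assumes adequate: "adequate S" and primitive: "primitive S z"
begin

lemma primitive_adequate_opp: "primitive_adequate (opp S) z"
  by (rule primitive_adequate.intro[OF zero_sgrp_opp])
    (unfold_locales, simp_all add: adequate primitive)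

text \<open>Since idempotents commute, \<open>e f\<close> is a nonzero idempotent below both
  \<open>e\<close> and \<open>f\<close>, and primitivity equates it with each of them.\<close>

lemma idempotents_eq:
  assumes "e \<in> idempotents S" "f \<in> idempotents S" "e \<odot> f \<noteq> z"
  shows "e = f"
proof -
  have comm: "e \<odot> f = f \<odot> e" using adequate assms by (simp add: adequate_def)
  have ef: "e \<in> carrier S" "f \<in> carrier S" "e \<odot> e = e" "f \<odot> f = f"
    using assms by (auto simp: idempotents_def)
  have 1: "e \<odot> (e \<odot> f) = e \<odot> f" "f \<odot> (e \<odot> f) = e \<odot> f"
    using ef comm smult_assoc by metis+
  have 2: "(e \<odot> f) \<odot> e = e \<odot> f" "(e \<odot> f) \<odot> f = e \<odot> f"
    using ef comm smult_assoc by metis+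
  have 3: "e \<odot> f \<in> idempotents S"
    using ef 1 2 by (simp add: idempotents_def smult_assoc)
  have "e \<noteq> z" "f \<noteq> z" using assms ef by auto
  then show ?thesis using primitive 1 2 3 assms unfolding primitive_def by metis
qed

lemma R_idempotent:
  assumes "a \<in> carrier S"
  obtains e where "e \<in> idempotents S" "e \<in> carrier S" "e \<odot> a = a"
    "\<And>x y. x \<in> carrier S \<Longrightarrow> y \<in> carrier S \<Longrightarrow> x \<odot> a = y \<odot> a \<Longrightarrow> x \<odot> e = y \<odot> e"
proof -
  obtain e where e: "e \<in> idempotents S" "R_star S a e"
    using adequate assms unfolding adequate_def abundant_def by blast
  note D = R_star_idempotentD[OF sgrp_axioms assms e]
  show thesis
  proof (rule that)
    show "e \<in> carrier S" using e(1) by (simp add: idempotents_def)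
  qed (fact e(1) D)+
qed

lemma L_idempotent:
  assumes "a \<in> carrier S"
  obtains e where "e \<in> idempotents S" "e \<in> carrier S" "a \<odot> e = a"
    "\<And>x y. x \<in> carrier S \<Longrightarrow> y \<in> carrier S \<Longrightarrow> a \<odot> x = a \<odot> y \<Longrightarrow> e \<odot> x = e \<odot> y"
proof -
  interpret op: primitive_adequate "opp S" z by (rule primitive_adequate_opp)
  show thesis using op.R_idempotent[of a] assms that unfolding opp_simps idempotents_opp by blast
qed

text \<open>From \<open>a b = a (e f) b\<close> it follows that \<open>e f\<close> is nonzero. This
  is the matching condition for composing arrows.\<close>

lemma idempotents_eq_of_mult:
  assumes "a \<in> carrier S" "b \<in> carrier S" "e \<in> idempotents S" "f \<in> idempotents S"
    and "a \<odot> e = a" "f \<odot> b = b" "a \<odot> b \<noteq> z"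
  shows "e = f"
proof (rule idempotents_eq)
  have ef: "e \<in> carrier S" "f \<in> carrier S" using assms by (auto simp: idempotents_def)
  have "a \<odot> b = a \<odot> (e \<odot> f) \<odot> b" using assms ef by (metis smult_assoc smult_closed)
  then show "e \<odot> f \<noteq> z" using assms(1,2,7) by (metis zero_simps(2,3))
qed (use assms in auto)

text \<open>Let \<open>e\<close> be the idempotent \<open>R_star\<close>-related to
  \<open>a\<close>. Right identities of \<open>b\<close> and \<open>c\<close> must both equal
  \<open>e\<close>, because \<open>b a\<close> and \<open>c a\<close> are nonzero. The relation
  yields \<open>b e = c e\<close>, which reads \<open>b = c\<close>.\<close>

lemma cancel_right:
  assumes "a \<in> carrier S" "b \<in> carrier S" "c \<in> carrier S" "b \<odot> a = c \<odot> a" "c \<odot> a \<noteq> z"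
  shows "b = c"
proof -
  obtain e where e: "e \<in> idempotents S" "e \<odot> a = a"
    "\<And>x y. x \<in> carrier S \<Longrightarrow> y \<in> carrier S \<Longrightarrow> x \<odot> a = y \<odot> a \<Longrightarrow> x \<odot> e = y \<odot> e"
    using assms(1) by (rule R_idempotent) blast
  obtain f where f: "f \<in> idempotents S" "b \<odot> f = b" using assms(2) by (rule L_idempotent) blast
  obtain g where g: "g \<in> idempotents S" "c \<odot> g = c" using assms(3) by (rule L_idempotent) blast
  have "b \<odot> a \<noteq> z" using assms(4,5) by simp
  then have "f = e" by (rule idempotents_eq_of_mult[OF assms(2,1) f(1) e(1) f(2) e(2)])
  moreover have "g = e"
    by (rule idempotents_eq_of_mult[OF assms(3,1) g(1) e(1) g(2) e(2) assms(5)])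
  ultimately show ?thesis using e(3)[OF assms(2,3,4)] f(2) g(2) by simp
qed

lemma cancel_left:
  assumes "a \<in> carrier S" "b \<in> carrier S" "c \<in> carrier S" "a \<odot> b = a \<odot> c" "a \<odot> c \<noteq> z"
  shows "b = c"
proof -
  interpret op: primitive_adequate "opp S" z by (rule primitive_adequate_opp)
  show ?thesis using op.cancel_right[of a b c] assms unfolding opp_simps by blast
qed

lemma zero_cancellative: "zero_cancellative S z"
  unfolding zero_cancellative_def using cancel_left cancel_right by blast

text \<open>The idempotent \<open>e\<close> that is \<open>L_star\<close>-related to
  \<open>a\<close> is also a left identity of \<open>b\<close>. If \<open>a (b c)\<close> were zero,
  it would equal \<open>a z\<close>, so \<open>e (b c) = e z = z\<close>; but
  \<open>e (b c) = b c\<close>.\<close>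

lemma categorical_at: "categorical_at S z"
  unfolding categorical_at_def
proof (intro ballI impI, elim conjE)
  fix a b c
  assume S: "a \<in> carrier S" "b \<in> carrier S" "c \<in> carrier S"
    and ne: "a \<odot> b \<noteq> z" "b \<odot> c \<noteq> z"
  obtain e where e: "e \<in> idempotents S" "e \<in> carrier S" "a \<odot> e = a"
    "\<And>x y. x \<in> carrier S \<Longrightarrow> y \<in> carrier S \<Longrightarrow> a \<odot> x = a \<odot> y \<Longrightarrow> e \<odot> x = e \<odot> y"
    using S(1) by (rule L_idempotent) blast
  obtain f where f: "f \<in> idempotents S" "f \<odot> b = b" using S(2) by (rule R_idempotent) blast
  have "e = f" using idempotents_eq_of_mult[OF S(1,2) e(1) f(1) e(3) f(2) ne(1)] .
  then have eb: "e \<odot> (b \<odot> c) = b \<odot> c" using S e f by (metis smult_assoc)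
  show "a \<odot> b \<odot> c \<noteq> z"
  proof
    assume "a \<odot> b \<odot> c = z"
    then have "a \<odot> (b \<odot> c) = a \<odot> z" using S by (simp add: smult_assoc)
    then have "e \<odot> (b \<odot> c) = e \<odot> z" using S by (intro e(4)) simp_all
    with eb e(2) ne(2) show False by simp
  qed
qed

lemma ex_left_identity: "a \<in> carrier S \<Longrightarrow> \<exists>e\<in>carrier S. e \<odot> a = a"
  by (erule R_idempotent) (rule bexI)

lemma ex_right_identity: "a \<in> carrier S \<Longrightarrow> \<exists>f\<in>carrier S. a \<odot> f = a"
  by (erule L_idempotent) (rule bexI)

end

section \<open>Zero-cancellative categorical semigroups\<close>

locale zero_category = zero_sgrp +
  assumes zero_canc: "zero_cancellative S z" and categorical: "categorical_at S z"
    and left_id: "a \<in> carrier S \<Longrightarrow> \<exists>e\<in>carrier S. e \<odot> a = a"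
    and right_id: "a \<in> carrier S \<Longrightarrow> \<exists>f\<in>carrier S. a \<odot> f = a"
begin

lemma zero_category_opp: "zero_category (opp S) z"
  by (rule zero_category.intro[OF zero_sgrp_opp])
    (unfold_locales, simp_all add: zero_cancellative_opp categorical_at_opp sgrp_axioms
      zero_canc categorical left_id right_id)

lemma cancel_left:
  "\<lbrakk>a \<odot> b = a \<odot> c; a \<odot> c \<noteq> z; a \<in> carrier S; b \<in> carrier S; c \<in> carrier S\<rbrakk> \<Longrightarrow> b = c"
  using zero_canc[unfolded zero_cancellative_def, rule_format, of a b c] by simp

lemma cancel_right:
  "\<lbrakk>b \<odot> a = c \<odot> a; c \<odot> a \<noteq> z; a \<in> carrier S; b \<in> carrier S; c \<in> carrier S\<rbrakk> \<Longrightarrow> b = c"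
  using zero_canc[unfolded zero_cancellative_def, rule_format, of a b c] by simp

lemma left_id_idempotent:
  assumes "e \<in> carrier S" "a \<in> carrier S" "e \<odot> a = a" "a \<noteq> z"
  shows "e \<odot> e = e"
  using cancel_right[of "e \<odot> e" a e] assms by (simp add: smult_assoc)

text \<open>Cancelling in \<open>e (e f) = e f\<close> gives \<open>e f = f\<close>, and cancelling
  in \<open>(e f) f = e f\<close> gives \<open>e f = e\<close>.\<close>

lemma idempotents_eq:
  assumes "e \<in> idempotents S" "f \<in> idempotents S" "e \<odot> f \<noteq> z"
  shows "e = f"
proof -
  have ef: "e \<in> carrier S" "f \<in> carrier S" "e \<odot> e = e" "f \<odot> f = f"
    using assms by (auto simp: idempotents_def)
  have "e \<odot> f = f"
    using cancel_left[of e "e \<odot> f" f] ef assms by (simp add: smult_assoc[symmetric])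
  moreover have "e \<odot> f = e"
    using cancel_right[of "e \<odot> f" f e] ef assms by (simp add: smult_assoc)
  ultimately show ?thesis by simp
qed

lemma ex_R_star_idempotent:
  assumes "a \<in> carrier S"
  shows "\<exists>e\<in>idempotents S. R_star S a e"
proof (cases "a = z")
  case True
  then have "z \<in> idempotents S" by (simp add: idempotents_def)
  with True show ?thesis by (auto simp: R_star_def)
next
  case False
  obtain e where e: "e \<in> carrier S" "e \<odot> a = a" using left_id assms by blast
  then have ee: "e \<odot> e = e" using left_id_idempotent assms False by blast
  \<comment> \<open>If \<open>x e\<close> were nonzero, then, \<open>e a = a\<close> being nonzero,
    categoricity would make \<open>x e a = x a\<close> nonzero.\<close>
  have zero: "x \<odot> e = z" if "x \<in> carrier S" "x \<odot> a = z" for x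
    using categorical e that assms False unfolding categorical_at_def by (metis smult_assoc)
  \<comment> \<open>Either both products with \<open>a\<close> vanish, and then so do those with
    \<open>e\<close>, or \<open>a\<close> can be cancelled and \<open>x = y\<close>.\<close>
  have "x \<odot> e = y \<odot> e" if "x \<in> carrier S" "y \<in> carrier S" "x \<odot> a = y \<odot> a" for x y
    using zero cancel_right[of x a y] that assms by metis
  moreover have "e \<in> idempotents S" using e ee by (simp add: idempotents_def)
  ultimately show ?thesis using R_star_idempotentI[OF sgrp_axioms assms _ e(2)] by blast
qed

lemma adequate: "adequate S"
  unfolding adequate_def abundant_def
proof (intro conjI ballI)
  show "\<exists>e\<in>idempotents S. R_star S a e" if "a \<in> carrier S" for a
    using that by (rule ex_R_star_idempotent)
  show "\<exists>e\<in>idempotents S. L_star S a e" if "a \<in> carrier S" for a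
    using zero_category.ex_R_star_idempotent[OF zero_category_opp, of a] that by simp
  show "e \<odot> f = f \<odot> e" if "e \<in> idempotents S" "f \<in> idempotents S" for e f
    using idempotents_eq that by metis
qed

lemma primitive: "primitive S z"
  unfolding primitive_def using idempotents_eq by metis

section \<open>Arrows, sources and targets\<close>

definition arr :: "'a set" where "arr = carrier S - {z}"
text \<open>The choice is arbitrary at \<open>z\<close>, but on arrows cancellation leaves only one
  candidate; see \<open>src_eqI\<close>.\<close>

definition src :: "'a \<Rightarrow> 'a" where "src a = (SOME e. e \<in> carrier S \<and> e \<odot> a = a)"
definition tgt :: "'a \<Rightarrow> 'a" where "tgt a = (SOME f. f \<in> carrier S \<and> a \<odot> f = a)"

lemma arr_carrier [simp]: "a \<in> arr \<Longrightarrow> a \<in> carrier S"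
  by (simp add: arr_def)

lemma arr_nonzero: "a \<in> arr \<Longrightarrow> a \<noteq> z"
  by (simp add: arr_def)

lemma zero_not_arr [simp]: "z \<notin> arr"
  by (simp add: arr_def)

lemma src_carrier: "a \<in> carrier S \<Longrightarrow> src a \<in> carrier S"
  and src_left [simp]: "a \<in> carrier S \<Longrightarrow> src a \<odot> a = a"
  using someI_ex[OF left_id[of a, unfolded Bex_def]] by (simp_all add: src_def)

lemma tgt_carrier: "a \<in> carrier S \<Longrightarrow> tgt a \<in> carrier S"
  and tgt_right [simp]: "a \<in> carrier S \<Longrightarrow> a \<odot> tgt a = a"
  using someI_ex[OF right_id[of a, unfolded Bex_def]] by (simp_all add: tgt_def)

lemma src_arr [simp]: "a \<in> arr \<Longrightarrow> src a \<in> arr"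
  unfolding arr_def by (metis Diff_iff singleton_iff src_carrier src_left zero_simps(2))

lemma tgt_arr [simp]: "a \<in> arr \<Longrightarrow> tgt a \<in> arr"
  unfolding arr_def by (metis Diff_iff singleton_iff tgt_carrier tgt_right zero_simps(3))

lemma src_eqI: "a \<in> arr \<Longrightarrow> e \<in> carrier S \<Longrightarrow> e \<odot> a = a \<Longrightarrow> src a = e"
  by (rule cancel_right[of _ a]) (simp_all add: arr_nonzero)

lemma tgt_eqI: "a \<in> arr \<Longrightarrow> e \<in> carrier S \<Longrightarrow> a \<odot> e = a \<Longrightarrow> tgt a = e"
  by (rule cancel_left[of a]) (simp_all add: arr_nonzero)

text \<open>Cancelling \<open>b\<close> in \<open>(a (src b)) b = a b\<close> shows that
  \<open>src b\<close> is a right identity of \<open>a\<close>, and an arrow has only one.\<close>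

lemma comp_arrD:
  assumes "a \<odot> b \<in> arr" "a \<in> carrier S" "b \<in> carrier S"
  shows "a \<in> arr" "b \<in> arr" "tgt a = src b"
proof -
  show a: "a \<in> arr" and b: "b \<in> arr" using assms by (auto simp: arr_def)
  have "(a \<odot> src b) \<odot> b = a \<odot> b" using a b by (simp add: smult_assoc)
  then have "a \<odot> src b = a"
    by (rule cancel_right) (use assms a b in \<open>simp_all add: arr_nonzero\<close>)
  then show "tgt a = src b" using a b by (intro tgt_eqI) simp_all
qed

text \<open>Categoricity applies to \<open>a\<close>, \<open>src b\<close>, \<open>b\<close>: both
  adjacent products are nonzero, being \<open>a\<close> and \<open>b\<close>.\<close>

lemma comp_arr [simp]:
  assumes "a \<in> arr" "b \<in> arr" "tgt a = src b"
  shows "a \<odot> b \<in> arr"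
proof -
  have "a \<odot> src b \<noteq> z" using assms(1) by (simp add: assms(3)[symmetric] arr_nonzero)
  moreover have "src b \<odot> b \<noteq> z" using assms(2) by (simp add: arr_nonzero)
  ultimately have "a \<odot> src b \<odot> b \<noteq> z"
    using categorical assms unfolding categorical_at_def by simp
  then show ?thesis using assms(1,2) by (simp add: arr_def smult_assoc src_carrier)
qed

lemma src_comp [simp]: "a \<in> arr \<Longrightarrow> b \<in> arr \<Longrightarrow> tgt a = src b \<Longrightarrow> src (a \<odot> b) = src a"
  by (rule src_eqI) (simp_all add: smult_assoc[symmetric])

lemma tgt_comp [simp]: "a \<in> arr \<Longrightarrow> b \<in> arr \<Longrightarrow> tgt a = src b \<Longrightarrow> tgt (a \<odot> b) = tgt b"
  by (rule tgt_eqI) (simp_all add: smult_assoc)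

lemma src_idem: "a \<in> arr \<Longrightarrow> src a \<odot> src a = src a"
  using left_id_idempotent[of "src a" a] by (simp add: arr_nonzero)

lemma tgt_src [simp]: "a \<in> arr \<Longrightarrow> tgt (src a) = src a"
  and src_src [simp]: "a \<in> arr \<Longrightarrow> src (src a) = src a"
  by (simp_all add: tgt_eqI src_eqI src_idem)

lemma cancel_left_arr:
  "a \<odot> b = a \<odot> c \<Longrightarrow> a \<odot> c \<in> arr \<Longrightarrow> a \<in> arr \<Longrightarrow> b \<in> arr \<Longrightarrow> c \<in> arr \<Longrightarrow> b = c"
  using cancel_left[of a b c] by (simp add: arr_nonzero)

lemma cancel_right_arr:
  "b \<odot> a = c \<odot> a \<Longrightarrow> c \<odot> a \<in> arr \<Longrightarrow> a \<in> arr \<Longrightarrow> b \<in> arr \<Longrightarrow> c \<in> arr \<Longrightarrow> b = c"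
  using cancel_right[of b a c] by (simp add: arr_nonzero)

lemma left_ore:
  assumes "transp_on (carrier S) (lam S z)" "a \<in> arr" "b \<in> arr" "tgt a = tgt b"
  obtains x y where "x \<in> arr" "y \<in> arr" "tgt x = src a" "tgt y = src b" "x \<odot> a = y \<odot> b"
proof -
  \<comment> \<open>The nonzero common left multiple of \<open>c\<close> and \<open>tgt c\<close> is
    \<open>c\<close> itself, as \<open>(src c) c = c (tgt c)\<close>.\<close>
  have lam_tgt: "lam S z c (tgt c)" "lam S z (tgt c) c" if "c \<in> arr" for c
  proof -
    have "src c \<odot> c = c" "c \<odot> tgt c = c" "c \<noteq> z"
      and S: "c \<in> carrier S" "src c \<in> carrier S" "tgt c \<in> carrier S"
      using that by (simp_all add: arr_nonzero)
    then show "lam S z c (tgt c)" "lam S z (tgt c) c"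
      unfolding lam_iff[OF zero S(1,3)] lam_iff[OF zero S(3,1)]
      by (intro disjI2 bexI[of _ "src c"] bexI[of _ c] conjI; (rule S | argo))+
  qed
  \<comment> \<open>Transitivity is used through the common target: \<open>a\<close> is related to
    \<open>tgt a = tgt b\<close>, which is related to \<open>b\<close>.\<close>
  have "lam S z a b"
    using lam_tgt(1)[OF assms(2)] lam_tgt(2)[OF assms(3)] assms
    by (auto intro: transp_onD[OF assms(1), of a "tgt b" b])
  then obtain x y where "x \<in> carrier S" "y \<in> carrier S" "x \<odot> a = y \<odot> b" "x \<odot> a \<noteq> z"
    using assms by (auto simp: lam_iff[OF zero] arr_nonzero)
  then have "x \<odot> a \<in> arr" "y \<odot> b \<in> arr" using assms by (simp_all add: arr_def)
  then show thesis
    using that \<open>x \<in> carrier S\<close> \<open>y \<in> carrier S\<close> \<open>x \<odot> a = y \<odot> b\<close> comp_arrD arr_carrier assms(2,3)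
    by metis
qed

end

section \<open>The semigroup of fractions\<close>

locale ore_zero_category = zero_category +
  assumes transp_lam: "transp_on (carrier S) (lam S z)"
    and transp_rho: "transp_on (carrier S) (rho S z)"
begin

lemma right_ore:
  assumes "a \<in> arr" "b \<in> arr" "src a = src b"
  obtains x y where "x \<in> arr" "y \<in> arr" "tgt a = src x" "tgt b = src y" "a \<odot> x = b \<odot> y"
proof -
  interpret op: zero_category "opp S" z by (rule zero_category_opp)
  \<comment> \<open>Reversal swaps the defining conditions of \<open>src\<close> and
    \<open>tgt\<close>, so even the chosen values coincide.\<close>
  have "op.arr = arr" "op.src = tgt" "op.tgt = src"
    by (simp_all add: op.arr_def arr_def op.src_def tgt_def op.tgt_def src_def fun_eq_iff)
  note op = this
  obtain x y where "x \<in> arr" "y \<in> arr" "src x = tgt a" "src y = tgt b" "a \<odot> x = b \<odot> y"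
    using op.left_ore[of a b, unfolded op opp_simps lam_opp] assms transp_rho by blast
  then show thesis using that by simp
qed

section \<open>Equality of left fractions\<close>

definition fracs :: "('a \<times> 'a) set" where
  "fracs = {(a, b). a \<in> arr \<and> b \<in> arr \<and> src a = src b}"

text \<open>The pair \<open>(a, b)\<close> stands for the left fraction \<open>a\<^sup>-\<^sup>1 b\<close>.\<close>

definition frac_eq :: "(('a \<times> 'a) \<times> ('a \<times> 'a)) set" where
  "frac_eq = {((a, b), (c, d)). (a, b) \<in> fracs \<and> (c, d) \<in> fracs \<and>
     (\<exists>x\<in>arr. \<exists>y\<in>arr. tgt x = src a \<and> tgt y = src c \<and> x \<odot> a = y \<odot> c \<and> x \<odot> b = y \<odot> d)}"

lemma fracs_iff [simp]: "(a, b) \<in> fracs \<longleftrightarrow> a \<in> arr \<and> b \<in> arr \<and> src a = src b"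
  by (simp add: fracs_def)

lemma frac_eqI:
  assumes "(a, b) \<in> fracs" "(c, d) \<in> fracs" "x \<in> arr" "y \<in> arr"
    "tgt x = src a" "tgt y = src c" "x \<odot> a = y \<odot> c" "x \<odot> b = y \<odot> d"
  shows "((a, b), (c, d)) \<in> frac_eq"
  using assms by (auto simp: frac_eq_def)

lemma frac_eqE:
  assumes "((a, b), (c, d)) \<in> frac_eq"
  obtains x y where "x \<in> arr" "y \<in> arr" "a \<in> arr" "b \<in> arr" "c \<in> arr" "d \<in> arr"
    "src b = src a" "src d = src c" "tgt x = src a" "tgt y = src c" "x \<odot> a = y \<odot> c" "x \<odot> b = y \<odot> d"
  using assms by (auto simp: frac_eq_def)

lemma frac_eq_fracs: "(p, q) \<in> frac_eq \<Longrightarrow> p \<in> fracs \<and> q \<in> fracs"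
  by (auto simp: frac_eq_def)

text \<open>The fraction \<open>a^-1 b\<close> runs from \<open>tgt a\<close> to
  \<open>tgt b\<close>, and left multiplication does not affect targets. These two ends decide which
  products are nonzero.\<close>

lemma frac_eq_tgt:
  assumes "((a, b), (c, d)) \<in> frac_eq"
  shows "tgt a = tgt c" "tgt b = tgt d"
  using assms by (auto elim!: frac_eqE; metis tgt_comp)+

lemma frac_eq_refl: "p \<in> fracs \<Longrightarrow> (p, p) \<in> frac_eq"
  by (cases p) (auto intro!: frac_eqI[where x = "src (fst p)" and y = "src (fst p)"])

lemma frac_eq_sym: "(p, q) \<in> frac_eq \<Longrightarrow> (q, p) \<in> frac_eq"
  by (auto simp: frac_eq_def) metis

text \<open>The witnessing conditions are symmetric in the two components. Swapping them represents
  inversion, \<open>(a^-1 b)^-1 = b^-1 a\<close>.\<close>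

lemma frac_eq_swap: "((a, b), (c, d)) \<in> frac_eq \<Longrightarrow> ((b, a), (d, c)) \<in> frac_eq"
  by (elim frac_eqE, rule frac_eqI) (auto)

text \<open>If \<open>x a = y c\<close> and \<open>u c = v e\<close>, the Ore condition gives \<open>g y = h u\<close>, and then
  \<open>g x\<close> and \<open>h v\<close> witness transitivity.\<close>

lemma frac_eq_trans:
  assumes "(p, q) \<in> frac_eq" "(q, r) \<in> frac_eq"
  shows "(p, r) \<in> frac_eq"
proof -
  obtain a b c d e f where pqr: "p = (a, b)" "q = (c, d)" "r = (e, f)"
    by (metis surj_pair)
  obtain x y where xy: "x \<in> arr" "y \<in> arr" "a \<in> arr" "b \<in> arr" "c \<in> arr" "d \<in> arr"
    "src b = src a" "src d = src c" "tgt x = src a" "tgt y = src c" "x \<odot> a = y \<odot> c" "x \<odot> b = y \<odot> d"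
    using assms(1) unfolding pqr by (rule frac_eqE)
  obtain u v where uv: "u \<in> arr" "v \<in> arr" "c \<in> arr" "d \<in> arr" "e \<in> arr" "f \<in> arr"
    "src d = src c" "src f = src e" "tgt u = src c" "tgt v = src e" "u \<odot> c = v \<odot> e" "u \<odot> d = v \<odot> f"
    using assms(2) unfolding pqr by (rule frac_eqE)
  obtain g h where gh: "g \<in> arr" "h \<in> arr" "tgt g = src y" "tgt h = src u" "g \<odot> y = h \<odot> u"
    using left_ore[OF transp_lam, of y u] xy uv by auto
  have x: "src x = src y" using xy by (metis src_comp)
  have v: "src v = src u" using xy uv by (metis src_comp)
  have gx: "(g \<odot> x) \<odot> a = (g \<odot> y) \<odot> c" "(g \<odot> x) \<odot> b = (g \<odot> y) \<odot> d"
    using xy(1-6,11,12) gh(1) by (simp_all add: smult_assoc)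
  have hu: "(h \<odot> u) \<odot> c = (h \<odot> v) \<odot> e" "(h \<odot> u) \<odot> d = (h \<odot> v) \<odot> f"
    using uv(1-6,11,12) gh(2) by (simp_all add: smult_assoc)
  have "(g \<odot> x) \<odot> a = (h \<odot> v) \<odot> e" "(g \<odot> x) \<odot> b = (h \<odot> v) \<odot> f"
    using gx hu gh(5) by simp_all
  then show ?thesis
    unfolding pqr by (rule frac_eqI[rotated -2]) (use xy(1-10) uv(1-10) gh(1-4) x v in simp_all)
qed

lemma frac_eq_common: "(p, r) \<in> frac_eq \<Longrightarrow> (q, r) \<in> frac_eq \<Longrightarrow> (p, q) \<in> frac_eq"
  using frac_eq_sym frac_eq_trans by blast

text \<open>Cancelling a common left factor: \<open>(x a)^-1 (x b) = a^-1 b\<close>. The witnesses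
  are the identity \<open>src x\<close> on one side and \<open>x\<close> on the other.\<close>

lemma frac_eq_expand:
  assumes "(a, b) \<in> fracs" "x \<in> arr" "tgt x = src a"
  shows "((x \<odot> a, x \<odot> b), (a, b)) \<in> frac_eq"
  using assms by (intro frac_eqI[of _ _ _ _ "src x" x]) (auto simp: smult_assoc[symmetric])

text \<open>From \<open>x a = y a\<close> it follows that \<open>x = y\<close>, after which
  \<open>x\<close> cancels in \<open>x b = x c\<close>. Thus a fixed denominator determines the
  numerator.\<close>

lemma frac_eq_left_same:
  assumes "((a, b), (a, c)) \<in> frac_eq"
  shows "b = c"
  using assms
proof (rule frac_eqE)
  fix x y
  assume *: "x \<in> arr" "y \<in> arr" "a \<in> arr" "b \<in> arr" "c \<in> arr" "src b = src a" "src c = src a"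
    "tgt x = src a" "tgt y = src a" "x \<odot> a = y \<odot> a" "x \<odot> b = y \<odot> c"
  then have "x = y" by (intro cancel_right_arr[of x a y]) auto
  with * show "b = c" by (intro cancel_left_arr[of y b c]) auto
qed

text \<open>Here \<open>x a = y c = x b\<close>, and \<open>x\<close> cancels. The diagonal pairs
  are the identities of the groupoid.\<close>

lemma frac_eq_diagonal:
  assumes "((a, b), (c, c)) \<in> frac_eq"
  shows "a = b"
  using assms
proof (rule frac_eqE)
  fix x y
  assume *: "x \<in> arr" "y \<in> arr" "a \<in> arr" "b \<in> arr" "c \<in> arr" "src b = src a"
    "tgt x = src a" "tgt y = src c" "x \<odot> a = y \<odot> c" "x \<odot> b = y \<odot> c"
  then show "a = b" by (intro cancel_left_arr[of x a b]) auto
qed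

text \<open>This makes \<open>(a^-1 b) (b^-1 c) = a^-1 c\<close> independent of representatives. The
  work lies in merging the two pairs of witnesses into a single pair \<open>g x\<close>,
  \<open>g y\<close>.\<close>

lemma frac_eq_comp:
  assumes "((a, b), (a', b')) \<in> frac_eq" "((b, c), (b', c')) \<in> frac_eq"
  shows "((a, c), (a', c')) \<in> frac_eq"
proof -
  obtain x y where xy: "x \<in> arr" "y \<in> arr" "a \<in> arr" "b \<in> arr" "a' \<in> arr" "b' \<in> arr"
    "src b = src a" "src b' = src a'" "tgt x = src a" "tgt y = src a'"
    "x \<odot> a = y \<odot> a'" "x \<odot> b = y \<odot> b'"
    using assms(1) by (rule frac_eqE)
  obtain u v where uv: "u \<in> arr" "v \<in> arr" "b \<in> arr" "c \<in> arr" "b' \<in> arr" "c' \<in> arr"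
    "src c = src b" "src c' = src b'" "tgt u = src b" "tgt v = src b'"
    "u \<odot> b = v \<odot> b'" "u \<odot> c = v \<odot> c'"
    using assms(2) by (rule frac_eqE)
  obtain g h where gh: "g \<in> arr" "h \<in> arr" "tgt g = src x" "tgt h = src u" "g \<odot> x = h \<odot> u"
    using left_ore[OF transp_lam, of x u] xy uv by auto
  have y: "src x = src y" using xy by (metis src_comp)
  have v: "src u = src v" using xy uv by (metis src_comp)
  have gy: "(g \<odot> x) \<odot> a = (g \<odot> y) \<odot> a'" "(g \<odot> x) \<odot> b = (g \<odot> y) \<odot> b'"
    using xy(1-6,11,12) gh(1) by (simp_all add: smult_assoc)
  have hv: "(h \<odot> u) \<odot> b = (h \<odot> v) \<odot> b'" "(h \<odot> u) \<odot> c = (h \<odot> v) \<odot> c'"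
    using uv(1-6,11,12) gh(2) by (simp_all add: smult_assoc)
  have arr: "g \<odot> x \<in> arr" "g \<odot> y \<in> arr" "h \<odot> v \<in> arr" "(h \<odot> v) \<odot> b' \<in> arr"
    using xy(1-6) uv(1-10) gh(1-4) y v by simp_all
  \<comment> \<open>The choice of \<open>g\<close> and \<open>h\<close> aligned the witnesses on the
    unprimed side; cancelling \<open>b'\<close> aligns them on the primed side too.\<close>
  have "(g \<odot> y) \<odot> b' = (h \<odot> v) \<odot> b'" using gy(2) hv(1) gh(5) by simp
  then have eq: "g \<odot> y = h \<odot> v" by (rule cancel_right_arr) (fact arr xy(6))+
  have "(g \<odot> x) \<odot> c = (g \<odot> y) \<odot> c'" unfolding gh(5) eq by (rule hv(2))
  with gy(1) show ?thesis
    by (rule frac_eqI[rotated -2]) (use xy(1-10) uv(1-10) gh(1-4) y arr in simp_all)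
qed

text \<open>The Ore condition gives \<open>x b = y c\<close>; expanding the first fraction by
  \<open>x\<close> and the second by \<open>y\<close> makes the inner components coincide. Hence
  fractions with matching ends always have representatives that can be multiplied.\<close>

lemma frac_eq_glue:
  assumes "((a, b), p) \<in> frac_eq" "((c, d), q) \<in> frac_eq" "tgt b = tgt c"
  obtains x y where "((x \<odot> a, x \<odot> b), p) \<in> frac_eq" "((x \<odot> b, y \<odot> d), q) \<in> frac_eq"
    "x \<in> arr" "tgt x = src a"
proof -
  have fr: "a \<in> arr" "b \<in> arr" "src a = src b" "c \<in> arr" "d \<in> arr" "src c = src d"
    using frac_eq_fracs[OF assms(1)] frac_eq_fracs[OF assms(2)] by auto
  obtain x y where xy: "x \<in> arr" "y \<in> arr" "tgt x = src b" "tgt y = src c" "x \<odot> b = y \<odot> c"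
    using left_ore[OF transp_lam fr(2,4) assms(3)] by blast
  have 1: "((x \<odot> a, x \<odot> b), (a, b)) \<in> frac_eq" using fr xy by (intro frac_eq_expand) auto
  have 2: "((x \<odot> b, y \<odot> d), (c, d)) \<in> frac_eq"
    unfolding xy(5) using fr xy by (intro frac_eq_expand) auto
  show thesis
    using that[of x y] frac_eq_trans[OF 1 assms(1)] frac_eq_trans[OF 2 assms(2)] fr xy by auto
qed

text \<open>The type of the carrier forces equivalence classes to be represented by chosen pairs.\<close>

definition rep :: "'a \<times> 'a \<Rightarrow> 'a \<times> 'a" where
  "rep p = (SOME q. (p, q) \<in> frac_eq)"

lemma frac_eq_rep: "p \<in> fracs \<Longrightarrow> (p, rep p) \<in> frac_eq"
  unfolding rep_def by (rule someI) (rule frac_eq_refl)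

lemma rep_eq:
  assumes "(p, q) \<in> frac_eq"
  shows "rep p = rep q"
proof -
  have "(p, r) \<in> frac_eq \<longleftrightarrow> (q, r) \<in> frac_eq" for r
    using assms by (blast intro: frac_eq_sym frac_eq_trans)
  then show ?thesis by (simp add: rep_def)
qed

section \<open>Multiplication of fractions\<close>

lemma frac_eq_nonzero: "(p, q) \<in> frac_eq \<Longrightarrow> q \<noteq> (z, z)"
  using frac_eq_fracs[of p q] by auto

text \<open>The rule is \<open>(a^-1 b) (b^-1 c) = a^-1 c\<close> on representatives sharing
  \<open>b\<close>. If there are none, the ends do not match and the product is the zero
  \<open>(z, z)\<close>, which is no fraction since \<open>z\<close> is no arrow. By
  \<open>frac_eq_comp\<close>, the result does not depend on the inner choice.\<close>

definition fmult :: "'a \<times> 'a \<Rightarrow> 'a \<times> 'a \<Rightarrow> 'a \<times> 'a" where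
  "fmult p q = (if \<exists>a b c. ((a, b), p) \<in> frac_eq \<and> ((b, c), q) \<in> frac_eq
     then rep (SOME r. \<exists>a b c. r = (a, c) \<and> ((a, b), p) \<in> frac_eq \<and> ((b, c), q) \<in> frac_eq)
     else (z, z))"

definition fractions :: "('a \<times> 'a) sgrp" where
  "fractions = \<lparr>carrier = insert (z, z) (rep ` fracs), smult = fmult\<rparr>"

lemma smult_fractions: "smult fractions = fmult"
  by (simp add: fractions_def)

lemma fmult_eq:
  assumes "((a, b), p) \<in> frac_eq" "((b, c), q) \<in> frac_eq"
  shows "fmult p q = rep (a, c)"
proof -
  define r where
    "r = (SOME r. \<exists>a b c. r = (a, c) \<and> ((a, b), p) \<in> frac_eq \<and> ((b, c), q) \<in> frac_eq)"
  have "\<exists>a b c. r = (a, c) \<and> ((a, b), p) \<in> frac_eq \<and> ((b, c), q) \<in> frac_eq"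
    unfolding r_def by (rule someI_ex) (use assms in blast)
  then obtain a' b' c' where r: "r = (a', c')" "((a', b'), p) \<in> frac_eq" "((b', c'), q) \<in> frac_eq"
    by blast
  have "((a', b'), (a, b)) \<in> frac_eq" "((b', c'), (b, c)) \<in> frac_eq"
    using frac_eq_trans[OF r(2) frac_eq_sym[OF assms(1)]]
      frac_eq_trans[OF r(3) frac_eq_sym[OF assms(2)]] .
  then have "rep r = rep (a, c)" unfolding r(1) by (rule rep_eq[OF frac_eq_comp])
  moreover have "fmult p q = rep r"
    unfolding fmult_def r_def by (rule if_P) (use assms in blast)
  ultimately show ?thesis by simp
qed

lemma fmult_cases:
  obtains "fmult p q = (z, z)"
  | a b c where "((a, b), p) \<in> frac_eq" "((b, c), q) \<in> frac_eq" "fmult p q = rep (a, c)"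
proof (cases "\<exists>a b c. ((a, b), p) \<in> frac_eq \<and> ((b, c), q) \<in> frac_eq")
  case True
  then show thesis using that(2) fmult_eq by blast
next
  case False
  then have "fmult p q = (z, z)" unfolding fmult_def by (rule if_not_P)
  then show thesis by (rule that(1))
qed

lemma chain_fracs: "((a, b), p) \<in> frac_eq \<Longrightarrow> ((b, c), q) \<in> frac_eq \<Longrightarrow> (a, c) \<in> fracs"
  by (auto dest!: frac_eq_fracs)

lemma frac_eq_fmult:
  assumes "((a, b), p) \<in> frac_eq" "((b, c), q) \<in> frac_eq"
  shows "((a, c), fmult p q) \<in> frac_eq"
  using fmult_eq[OF assms] frac_eq_rep[OF chain_fracs[OF assms]] by simp

lemma carrier_fmult: "fmult p q \<in> insert (z, z) (rep ` fracs)"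
  by (rule fmult_cases[of p q]) (use chain_fracs in \<open>simp_all del: fracs_iff\<close>)

lemma fmult_nonzeroE:
  assumes "fmult p q \<noteq> (z, z)"
  obtains a b c where "((a, b), p) \<in> frac_eq" "((b, c), q) \<in> frac_eq" "fmult p q = rep (a, c)"
  using assms by (rule_tac fmult_cases[of p q]) blast+

lemma fmult_zero_left [simp]: "fmult (z, z) q = (z, z)"
  by (rule fmult_cases[of "(z, z)" q]) (use frac_eq_nonzero in blast)+

lemma fmult_zero_right [simp]: "fmult p (z, z) = (z, z)"
  by (rule fmult_cases[of p "(z, z)"]) (use frac_eq_nonzero in blast)+

text \<open>Nonzero members of the carrier are chosen representatives, and equivalent pairs have the
  same one, so in the carrier equivalence becomes equality.\<close>

lemma frac_eq_carrier:
  assumes "p \<in> rep ` fracs" "(q, p) \<in> frac_eq"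
  shows "p = rep q"
proof -
  obtain r where r: "p = rep r" "r \<in> fracs" using assms(1) by (rule imageE)
  have "(r, q) \<in> frac_eq" using frac_eq_common[OF frac_eq_rep[OF r(2)], of q] assms(2) r(1) by simp
  then show ?thesis using r(1) by (simp add: rep_eq)
qed

lemma fmult_assoc_chain:
  assumes "((a, b), p) \<in> frac_eq" "((b, c), q) \<in> frac_eq" "((c, d), r) \<in> frac_eq"
  shows "fmult (fmult p q) r = fmult p (fmult q r)"
  using fmult_eq[OF frac_eq_fmult[OF assms(1,2)] assms(3)]
    fmult_eq[OF assms(1) frac_eq_fmult[OF assms(2,3)]] by simp

text \<open>If either bracketing is nonzero, the ends of \<open>p\<close>, \<open>q\<close>,
  \<open>r\<close> match. Representatives forming one chain \<open>(a, b)\<close>,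
  \<open>(b, c)\<close>, \<open>(c, d)\<close> then exist, and on these both bracketings give
  \<open>a^-1 d\<close>.\<close>

lemma fmult_assoc: "fmult (fmult p q) r = fmult p (fmult q r)"
proof (cases "fmult (fmult p q) r = (z, z) \<and> fmult p (fmult q r) = (z, z)")
  case False
  then consider "fmult (fmult p q) r \<noteq> (z, z)" | "fmult p (fmult q r) \<noteq> (z, z)" by blast
  \<comment> \<open>In both cases the first link is established outright, while for the second only
    equality of targets is claimed.\<close>
  then have "\<exists>a b c c' d. ((a, b), p) \<in> frac_eq \<and> ((b, c), q) \<in> frac_eq \<and>
    ((c', d), r) \<in> frac_eq \<and> tgt c = tgt c'"
  proof cases
    case 1
    then obtain a c d where acd: "((a, c), fmult p q) \<in> frac_eq" "((c, d), r) \<in> frac_eq"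
      "fmult (fmult p q) r = rep (a, d)"
      by (rule fmult_nonzeroE)
    have "fmult p q \<noteq> (z, z)" using 1 by auto
    then obtain a' b' c' where abc: "((a', b'), p) \<in> frac_eq" "((b', c'), q) \<in> frac_eq"
      "fmult p q = rep (a', c')"
      by (rule fmult_nonzeroE)
    have "((a', c'), (a, c)) \<in> frac_eq"
      using frac_eq_fmult[OF abc(1,2)] acd(1) by (blast intro: frac_eq_sym frac_eq_trans)
    then show ?thesis using abc(1,2) acd(2) frac_eq_tgt(2) by blast
  next
    case 2
    then obtain a b d where abd: "((a, b), p) \<in> frac_eq" "((b, d), fmult q r) \<in> frac_eq"
      "fmult p (fmult q r) = rep (a, d)"
      by (rule fmult_nonzeroE)
    have "fmult q r \<noteq> (z, z)" using 2 by auto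
    then obtain b' c' d' where bcd: "((b', c'), q) \<in> frac_eq" "((c', d'), r) \<in> frac_eq"
      "fmult q r = rep (b', d')"
      by (rule fmult_nonzeroE)
    have "((b, d), (b', d')) \<in> frac_eq"
      using frac_eq_fmult[OF bcd(1,2)] abd(2) by (blast intro: frac_eq_sym frac_eq_trans)
    then have tb: "tgt b = tgt b'" by (rule frac_eq_tgt)
    \<comment> \<open>Gluing may change the representative of \<open>q\<close>, but its second
      component keeps the target of \<open>c'\<close>.\<close>
    obtain x y where xy: "((x \<odot> a, x \<odot> b), p) \<in> frac_eq" "((x \<odot> b, y \<odot> c'), q) \<in> frac_eq"
      using frac_eq_glue[OF abd(1) bcd(1) tb] by metis
    have "((x \<odot> b, y \<odot> c'), (b', c')) \<in> frac_eq"
      using xy(2) bcd(1) by (blast intro: frac_eq_sym frac_eq_trans)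
    then show ?thesis using xy(1,2) bcd(2) frac_eq_tgt(2)[of _ "y \<odot> c'"] by blast
  qed
  then obtain a b c c' d where *: "((a, b), p) \<in> frac_eq" "((b, c), q) \<in> frac_eq"
    "((c', d), r) \<in> frac_eq" "tgt c = tgt c'" by blast
  \<comment> \<open>Closing the second link expands \<open>q\<close> by \<open>x\<close>; expanding
    \<open>p\<close> by the same \<open>x\<close> preserves the first link.\<close>
  obtain x y where xy: "((x \<odot> b, x \<odot> c), q) \<in> frac_eq" "((x \<odot> c, y \<odot> d), r) \<in> frac_eq"
    "x \<in> arr" "tgt x = src b"
    using frac_eq_glue[OF *(2,3,4)] by metis
  have fr: "a \<in> arr" "b \<in> arr" "src a = src b" using frac_eq_fracs[OF *(1)] by auto
  then have "((x \<odot> a, x \<odot> b), p) \<in> frac_eq"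
    using frac_eq_trans[OF frac_eq_expand *(1), of x] xy by auto
  then show ?thesis using xy(1,2) by (rule fmult_assoc_chain)
qed simp

section \<open>Inverses and idempotents among fractions\<close>

lemma sgrp_fractions: "sgrp fractions"
  using carrier_fmult by unfold_locales (auto simp: fractions_def fmult_assoc)

lemma is_zero_fractions: "is_zero fractions (z, z)"
  by (simp add: is_zero_def fractions_def)

lemma is_inverse_fractions:
  assumes "p \<in> carrier fractions"
  shows "p = (z, z) \<Longrightarrow> is_inverse fractions p q \<longleftrightarrow> q = (z, z)"
    and "((a, b), p) \<in> frac_eq \<Longrightarrow> is_inverse fractions p q \<longleftrightarrow> q = rep (b, a)"
proof -
  show "is_inverse fractions p q \<longleftrightarrow> q = (z, z)" if "p = (z, z)"
    using that by (auto simp: is_inverse_def fractions_def)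
  assume ab: "((a, b), p) \<in> frac_eq"
  then have "p \<noteq> (z, z)" by (rule frac_eq_nonzero)
  then have p: "p \<in> rep ` fracs" using assms by (auto simp: fractions_def)
  have ba: "(b, a) \<in> fracs" using frac_eq_fracs[OF ab] by auto
  show "is_inverse fractions p q \<longleftrightarrow> q = rep (b, a)"
  proof
    assume q: "q = rep (b, a)"
    then have bq: "((b, a), q) \<in> frac_eq" using ba by (simp add: frac_eq_rep)
    have "fmult (fmult p q) p = rep (a, b)" "fmult (fmult q p) q = rep (b, a)"
      by (rule fmult_eq[OF frac_eq_fmult]; fact ab bq)+
    then show "is_inverse fractions p q"
      using ba q frac_eq_carrier[OF p ab] by (simp add: is_inverse_def fractions_def)
  next
    assume inv: "is_inverse fractions p q"
    then have pqp: "fmult p (fmult q p) = p"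
      by (simp add: is_inverse_def fractions_def fmult_assoc)
    with \<open>p \<noteq> (z, z)\<close> have "fmult p (fmult q p) \<noteq> (z, z)" by simp
    then obtain a1 b1 d1 where 1: "((a1, b1), p) \<in> frac_eq" "((b1, d1), fmult q p) \<in> frac_eq"
      "fmult p (fmult q p) = rep (a1, d1)"
      by (rule fmult_nonzeroE)
    \<comment> \<open>Both \<open>p\<close> and \<open>p (q p)\<close> are now written with
      denominator \<open>a1\<close>, so their numerators agree and \<open>q p\<close> is the
      identity \<open>b1^-1 b1\<close>.\<close>
    have "((a1, d1), p) \<in> frac_eq"
      using frac_eq_fmult[OF 1(1,2)] pqp by simp
    with 1(1) have "((a1, b1), (a1, d1)) \<in> frac_eq" by (rule frac_eq_common)
    then have "b1 = d1" by (rule frac_eq_left_same)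
    have "fmult q p \<noteq> (z, z)" using 1(2) by (rule frac_eq_nonzero)
    then obtain b2 c2 d2 where 2: "((b2, c2), q) \<in> frac_eq" "((c2, d2), p) \<in> frac_eq"
      "fmult q p = rep (b2, d2)"
      by (rule fmult_nonzeroE)
    \<comment> \<open>An identity has only diagonal representatives, so \<open>d2 = b2\<close>. Then
      \<open>p\<close> is \<open>c2^-1 b2\<close>, and \<open>q\<close> is the swapped pair.\<close>
    have "((b2, d2), (b1, b1)) \<in> frac_eq"
      using frac_eq_common[OF frac_eq_fmult[OF 2(1,2)] 1(2)] \<open>b1 = d1\<close> by simp
    then have "b2 = d2" by (rule frac_eq_diagonal)
    then have "((a, b), (c2, b2)) \<in> frac_eq" using frac_eq_common[OF ab 2(2)] by simp
    then have "((b, a), q) \<in> frac_eq" by (rule frac_eq_trans[OF frac_eq_swap 2(1)])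
    moreover have "q \<in> rep ` fracs"
      using inv frac_eq_nonzero[OF 2(1)] by (simp add: is_inverse_def fractions_def)
    ultimately show "q = rep (b, a)" by (intro frac_eq_carrier)
  qed
qed

lemma carrier_fractionsE:
  assumes "p \<in> carrier fractions" "p \<noteq> (z, z)"
  obtains a b where "((a, b), p) \<in> frac_eq" "a \<in> arr" "b \<in> arr" "src a = src b"
proof -
  have "p \<in> rep ` fracs" using assms by (simp add: fractions_def)
  then obtain q where q: "p = rep q" "q \<in> fracs" by (rule imageE)
  obtain a b where "q = (a, b)" by (rule prod.exhaust)
  then show thesis using that[of a b] frac_eq_rep[of q] q by simp
qed

lemma inverse_semigroup_fractions: "inverse_semigroup fractions"
  unfolding inverse_semigroup_def
proof (intro conjI ballI)
  fix p assume p: "p \<in> carrier fractions"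
  show "\<exists>!q. is_inverse fractions p q"
  proof (cases "p = (z, z)")
    case True
    show ?thesis unfolding is_inverse_fractions(1)[OF p True] by blast
  next
    case False
    obtain a b where ab: "((a, b), p) \<in> frac_eq" using p False by (rule carrier_fractionsE)
    show ?thesis unfolding is_inverse_fractions(2)[OF p ab] by blast
  qed
qed (rule sgrp_fractions)

lemma sinv_fractions:
  assumes "((a, b), p) \<in> frac_eq" "p \<in> carrier fractions"
  shows "sinv fractions p = rep (b, a)"
  unfolding sinv_def is_inverse_fractions(2)[OF assms(2,1)]
  by simp

lemma sinv_fractions_zero: "sinv fractions (z, z) = (z, z)"
proof -
  have "(z, z) \<in> carrier fractions" by (simp add: fractions_def)
  then show ?thesis
    unfolding sinv_def by (intro the_equality) (simp_all add: is_inverse_fractions(1))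
qed

text \<open>Writing \<open>p p = p\<close> as \<open>(a1^-1 b1) (b1^-1 c1) = a1^-1 b1\<close> gives
  \<open>c1 = b1\<close>. The second factor, again \<open>p\<close>, is therefore an identity, so
  all its representatives are diagonal.\<close>

lemma idempotent_fractions:
  assumes "p \<in> idempotents fractions" "((a, b), p) \<in> frac_eq"
  shows "a = b"
proof -
  have p: "p \<in> carrier fractions" "fmult p p = p"
    using assms(1) by (auto simp: idempotents_def fractions_def)
  have "fmult p p \<noteq> (z, z)" using frac_eq_nonzero[OF assms(2)] p(2) by simp
  then obtain a1 b1 c1 where 1: "((a1, b1), p) \<in> frac_eq" "((b1, c1), p) \<in> frac_eq"
    "fmult p p = rep (a1, c1)"
    by (rule fmult_nonzeroE)
  have "((a1, c1), p) \<in> frac_eq" using frac_eq_fmult[OF 1(1,2)] p(2) by simp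
  with 1(1) have "((a1, b1), (a1, c1)) \<in> frac_eq" by (rule frac_eq_common)
  then have "b1 = c1" by (rule frac_eq_left_same)
  then have "((a, b), (b1, b1)) \<in> frac_eq" using frac_eq_common[OF assms(2) 1(2)] by simp
  then show ?thesis by (rule frac_eq_diagonal)
qed

text \<open>In a nonzero product \<open>e f\<close> the representatives \<open>(a, b)\<close> and
  \<open>(b, c)\<close> are both diagonal, hence equal, and so \<open>e = f\<close>.\<close>

lemma primitive_fractions: "primitive fractions (z, z)"
  unfolding primitive_def
proof (intro ballI impI, elim conjE)
  fix e f
  assume ef: "e \<in> idempotents fractions" "f \<in> idempotents fractions" "e \<noteq> (z, z)"
    "e \<odot>\<^bsub>fractions\<^esub> f = f"
  show "f = (z, z) \<or> f = e"
  proof (cases "f = (z, z)")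
    case False
    then have "fmult e f \<noteq> (z, z)" using ef(4) by (simp add: fractions_def)
    then obtain a b c where abc: "((a, b), e) \<in> frac_eq" "((b, c), f) \<in> frac_eq"
      "fmult e f = rep (a, c)"
      by (rule fmult_nonzeroE)
    have "a = b" "b = c" using idempotent_fractions ef(1,2) abc(1,2) by blast+
    moreover have "e \<in> rep ` fracs" "f \<in> rep ` fracs"
      using ef False by (auto simp: idempotents_def fractions_def)
    ultimately show ?thesis using abc(1,2) frac_eq_carrier by metis
  qed simp
qed

lemma primitive_inverse_semigroup_fractions: "primitive_inverse_semigroup fractions"
  unfolding primitive_inverse_semigroup_def
  using inverse_semigroup_fractions is_zero_fractions primitive_fractions by blast

section \<open>Embedding by fractions with identity denominators\<close>

definition emb :: "'a \<Rightarrow> 'a \<times> 'a" where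
  "emb a = (if a = z then (z, z) else rep (src a, a))"

lemma emb_zero [simp]: "emb z = (z, z)"
  by (simp add: emb_def)

text \<open>The zero is a separate case of \<open>emb\<close> because \<open>(src z, z)\<close> is
  not in \<open>fracs\<close>.\<close>

lemma emb_carrier: "a \<in> carrier S \<Longrightarrow> emb a \<in> carrier fractions"
  using src_arr[of a] src_src[of a] by (cases "a = z") (auto simp: emb_def fractions_def arr_def)

lemma frac_eq_emb: "a \<in> arr \<Longrightarrow> ((src a, a), emb a) \<in> frac_eq"
  using frac_eq_rep[of "(src a, a)"] by (simp add: emb_def arr_nonzero)

lemma emb_mult:
  assumes "a \<in> carrier S" "b \<in> carrier S"
  shows "emb (a \<odot> b) = fmult (emb a) (emb b)"
proof (cases "a \<odot> b = z")
  case True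
  \<comment> \<open>A nonzero product would supply an inner component \<open>d\<close> with
    \<open>tgt d = tgt a\<close> and \<open>tgt d = tgt (src b) = src b\<close>, so \<open>a\<close>
    and \<open>b\<close> would compose.\<close>
  have "fmult (emb a) (emb b) = (z, z)"
  proof (rule ccontr)
    assume "fmult (emb a) (emb b) \<noteq> (z, z)"
    then obtain c d e where cde: "((c, d), emb a) \<in> frac_eq" "((d, e), emb b) \<in> frac_eq"
      "fmult (emb a) (emb b) = rep (c, e)"
      by (rule fmult_nonzeroE)
    have ab: "a \<in> arr" "b \<in> arr"
      using frac_eq_fracs[OF cde(1)] frac_eq_fracs[OF cde(2)] assms by (auto simp: arr_def)
    have "((c, d), (src a, a)) \<in> frac_eq" "((d, e), (src b, b)) \<in> frac_eq"
      using frac_eq_common[OF cde(1)] frac_eq_common[OF cde(2)] frac_eq_emb ab by simp_all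
    then have "tgt d = tgt a" "tgt d = src b" using frac_eq_tgt ab(2) tgt_src by metis+
    then have "tgt a = src b" by simp
    then show False using comp_arr[OF ab] True by (simp add: arr_def)
  qed
  then show ?thesis using True by simp
next
  case False
  then have "a \<odot> b \<in> arr" using assms by (simp add: arr_def)
  then have ab: "a \<in> arr" "b \<in> arr" "tgt a = src b"
    using assms by (fact comp_arrD)+
  \<comment> \<open>Expanding \<open>(src b, b)\<close> by \<open>a\<close> produces
    \<open>(a, a b)\<close>, which chains with \<open>(src a, a)\<close>.\<close>
  have "((a \<odot> src b, a \<odot> b), (src b, b)) \<in> frac_eq"
    using ab by (intro frac_eq_expand) auto
  moreover have "a \<odot> src b = a" unfolding ab(3)[symmetric] using ab(1) by simp
  ultimately have "((a, a \<odot> b), emb b) \<in> frac_eq"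
    using frac_eq_trans[OF _ frac_eq_emb[OF ab(2)], of "(a, a \<odot> b)"] by simp
  then have "fmult (emb a) (emb b) = rep (src a, a \<odot> b)"
    using fmult_eq[OF frac_eq_emb[OF ab(1)]] by blast
  then show ?thesis using ab False by (simp add: emb_def)
qed

lemma emb_inj: "inj_on emb (carrier S)"
proof (rule inj_onI)
  fix a b
  assume ab: "a \<in> carrier S" "b \<in> carrier S" "emb a = emb b"
  show "a = b"
  proof (cases "a = z \<or> b = z")
    case True
    have "emb c \<noteq> (z, z)" if "c \<in> arr" for c
      using frac_eq_fracs[OF frac_eq_emb[OF that]] by auto
    then have "emb c = (z, z) \<Longrightarrow> c \<in> carrier S \<Longrightarrow> c = z" for c by (auto simp: arr_def)
    then show ?thesis using True ab by (metis emb_zero)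
  next
    case False
    then have arr: "a \<in> arr" "b \<in> arr" using ab by (auto simp: arr_def)
    have "((src a, a), (src b, b)) \<in> frac_eq"
      using frac_eq_common[OF frac_eq_emb[OF arr(1)]] frac_eq_emb[OF arr(2)] ab(3) by simp
    then show ?thesis
    proof (rule frac_eqE)
      fix x y
      assume *: "x \<in> arr" "y \<in> arr" "tgt x = src (src a)" "tgt y = src (src b)"
        "x \<odot> src a = y \<odot> src b" "x \<odot> a = y \<odot> b"
      \<comment> \<open>The denominators are identities, so their witnessing equation reduces to
        \<open>x = y\<close>, leaving \<open>x a = x b\<close> to cancel.\<close>
      then have "x \<odot> src a = x" "y \<odot> src b = y" using arr by (metis arr_carrier src_src tgt_right)+
      then have "x = y" using * by simp
      with * show "a = b" using arr by (intro cancel_left_arr[of y a b]) auto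
    qed
  qed
qed

lemma I_order_fractions: "I_order_in S fractions"
  unfolding I_order_in_def
proof (intro exI conjI)
  show "sgrp_embedding S fractions emb"
    unfolding sgrp_embedding_def
    using emb_carrier emb_inj by (simp add: image_subset_iff) (simp add: fractions_def emb_mult)
  have fz: "(z, z) = sinv fractions (emb z) \<odot>\<^bsub>fractions\<^esub> emb z"
    "(z, z) = emb z \<odot>\<^bsub>fractions\<^esub> sinv fractions (emb z)"
    by (simp_all add: sinv_fractions_zero) (simp_all add: fractions_def)
  have inv: "((a, src a), sinv fractions (emb a)) \<in> frac_eq" if "a \<in> arr" for a
    using sinv_fractions[OF frac_eq_emb[OF that] emb_carrier] frac_eq_rep[of "(a, src a)"] that
    by simp
  have left: "\<exists>a\<in>carrier S. \<exists>b\<in>carrier S. p = sinv fractions (emb a) \<odot>\<^bsub>fractions\<^esub> emb b"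
    if p: "p \<in> carrier fractions" for p
  proof (cases "p = (z, z)")
    case True
    show ?thesis unfolding True by (intro bexI[of _ z]) (fact fz, simp_all)
  next
    case False
    obtain a b where ab: "((a, b), p) \<in> frac_eq" "a \<in> arr" "b \<in> arr" "src a = src b"
      using p False by (rule carrier_fractionsE)
    \<comment> \<open>The chain is \<open>(a, src a)\<close>, \<open>(src b, b)\<close>; it fits
      because \<open>src a = src b\<close>.\<close>
    have "fmult (sinv fractions (emb a)) (emb b) = rep (a, b)"
      using fmult_eq[OF inv[OF ab(2)], of b] frac_eq_emb[OF ab(3)] ab(4) by simp
    moreover have "p = rep (a, b)"
      using p False by (intro frac_eq_carrier[OF _ ab(1)]) (auto simp: fractions_def)
    ultimately have "p = sinv fractions (emb a) \<odot>\<^bsub>fractions\<^esub> emb b"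
      by (simp add: smult_fractions)
    then show ?thesis using ab(2,3) by (intro bexI[of _ a] bexI[of _ b]) simp_all
  qed
  have right: "\<exists>c\<in>carrier S. \<exists>d\<in>carrier S. p = emb c \<odot>\<^bsub>fractions\<^esub> sinv fractions (emb d)"
    if p: "p \<in> carrier fractions" for p
  proof (cases "p = (z, z)")
    case True
    show ?thesis unfolding True by (intro bexI[of _ z]) (fact fz, simp_all)
  next
    case False
    obtain a b where ab: "((a, b), p) \<in> frac_eq" "a \<in> arr" "b \<in> arr" "src a = src b"
      using p False by (rule carrier_fractionsE)
    \<comment> \<open>From \<open>a c = b d\<close> comes \<open>a^-1 b = c d^-1\<close>. In pairs,
      \<open>c\<close> is expanded to \<open>(a, a c)\<close> and \<open>d^-1\<close> to
      \<open>(b d, b)\<close>, which chain to \<open>(a, b)\<close>.\<close>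
    obtain c d where cd: "c \<in> arr" "d \<in> arr" "tgt a = src c" "tgt b = src d" "a \<odot> c = b \<odot> d"
      using right_ore[OF ab(2,3,4)] .
    have "((a \<odot> src c, a \<odot> c), (src c, c)) \<in> frac_eq" "((b \<odot> d, b \<odot> src d), (d, src d)) \<in> frac_eq"
      using ab(2,3) cd(1-4) by (simp_all add: frac_eq_expand)
    moreover have "a \<odot> src c = a" "b \<odot> src d = b"
      unfolding cd(3,4)[symmetric] using ab(2,3) by simp_all
    ultimately have "((a, a \<odot> c), emb c) \<in> frac_eq" "((a \<odot> c, b), sinv fractions (emb d)) \<in> frac_eq"
      using frac_eq_trans[OF _ frac_eq_emb[OF cd(1)], of "(a, a \<odot> c)"]
        frac_eq_trans[OF _ inv[OF cd(2)], of "(a \<odot> c, b)"] cd(5) by simp_all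
    then have "fmult (emb c) (sinv fractions (emb d)) = rep (a, b)" by (rule fmult_eq)
    moreover have "p = rep (a, b)"
      using p False by (intro frac_eq_carrier[OF _ ab(1)]) (auto simp: fractions_def)
    ultimately have "p = emb c \<odot>\<^bsub>fractions\<^esub> sinv fractions (emb d)"
      by (simp add: smult_fractions)
    then show ?thesis using cd(1,2) by (intro bexI[of _ c] bexI[of _ d]) simp_all
  qed
  show "sub_I_order (emb ` carrier S) fractions"
    unfolding sub_I_order_def subsemigroup_def
  proof (intro conjI ballI)
    show "emb ` carrier S \<subseteq> carrier fractions" using emb_carrier by auto
    show "a \<odot>\<^bsub>fractions\<^esub> b \<in> emb ` carrier S" if "a \<in> emb ` carrier S" "b \<in> emb ` carrier S" for a b
    proof -
      from that obtain c d where "a = emb c" "b = emb d" "c \<in> carrier S" "d \<in> carrier S" by blast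
      then have "a \<odot>\<^bsub>fractions\<^esub> b = emb (c \<odot> d)" "c \<odot> d \<in> carrier S"
        by (simp_all add: smult_fractions emb_mult)
      then show ?thesis by blast
    qed
  qed (use left right in auto)
qed

end

section \<open>I-orders in primitive inverse semigroups\<close>

locale primitive_inverse = sgrp Q for Q :: "'q sgrp" (structure) +
  fixes w :: 'q
  assumes ex1_inverse: "a \<in> carrier Q \<Longrightarrow> \<exists>!b. is_inverse Q a b"
    and zero: "is_zero Q w" and primitive: "primitive Q w"
begin

sublocale zero_sgrp Q w
  by unfold_locales (rule zero)

lemma is_inverse_sinv: "a \<in> carrier Q \<Longrightarrow> is_inverse Q a (sinv Q a)"
  unfolding sinv_def by (rule theI') (rule ex1_inverse)

lemma sinv_closed [simp]: "a \<in> carrier Q \<Longrightarrow> sinv Q a \<in> carrier Q"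
  using is_inverse_sinv by (simp add: is_inverse_def)

lemma sinv_mult [simp]:
  assumes "a \<in> carrier Q"
  shows "a \<odot> sinv Q a \<odot> a = a" "sinv Q a \<odot> a \<odot> sinv Q a = sinv Q a"
  using is_inverse_sinv[OF assms] by (simp_all add: is_inverse_def)

lemma sinv_mult' [simp]:
  assumes "a \<in> carrier Q"
  shows "a \<odot> (sinv Q a \<odot> a) = a" "sinv Q a \<odot> (a \<odot> sinv Q a) = sinv Q a"
  using sinv_mult[OF assms] assms by (simp_all add: smult_assoc)

lemma sinv_mult_assoc [simp]:
  assumes "a \<in> carrier Q" "b \<in> carrier Q"
  shows "a \<odot> (sinv Q a \<odot> (a \<odot> b)) = a \<odot> b"
    "sinv Q a \<odot> (a \<odot> (sinv Q a \<odot> b)) = sinv Q a \<odot> b"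
  using sinv_mult[OF assms(1)] assms by (metis smult_assoc smult_closed sinv_closed)+

lemma is_inverse_unique:
  "\<lbrakk>is_inverse Q a b; is_inverse Q a c; a \<in> carrier Q\<rbrakk> \<Longrightarrow> b = c"
  using ex1_inverse by blast

text \<open>With \<open>x\<close> the inverse of \<open>e f\<close>, also \<open>f x e\<close> is an
  inverse of \<open>e f\<close>, so \<open>x = f x e\<close>, which is idempotent. An idempotent is
  its own inverse; as \<open>e f\<close> is an inverse of \<open>x\<close> too,
  \<open>e f = x\<close>.\<close>

lemma idempotents_mult_closed:
  assumes "e \<in> idempotents Q" "f \<in> idempotents Q"
  shows "e \<odot> f \<in> idempotents Q"
proof -
  have e: "e \<in> carrier Q" "e \<odot> e = e" and f: "f \<in> carrier Q" "f \<odot> f = f"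
    using assms by (auto simp: idempotents_def)
  have ee: "e \<odot> (e \<odot> y) = e \<odot> y" and ff: "f \<odot> (f \<odot> y) = f \<odot> y" if "y \<in> carrier Q" for y
    using that e f by (simp_all add: smult_assoc[symmetric])
  define x where "x = sinv Q (e \<odot> f)"
  have x: "x \<in> carrier Q" "is_inverse Q (e \<odot> f) x"
    using e f by (simp_all add: x_def is_inverse_sinv)
  then have xx: "e \<odot> (f \<odot> (x \<odot> (e \<odot> f))) = e \<odot> f" "x \<odot> (e \<odot> (f \<odot> x)) = x"
    using e f by (simp_all add: is_inverse_def smult_assoc)
  then have xx': "x \<odot> (e \<odot> (f \<odot> (x \<odot> y))) = x \<odot> y" if "y \<in> carrier Q" for y
    using that e f x(1) by (metis smult_assoc smult_closed)
  let ?g = "f \<odot> x \<odot> e"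
  have "is_inverse Q (e \<odot> f) ?g"
    using e f x(1) xx by (simp add: is_inverse_def smult_assoc ee ff xx')
  then have "x = ?g" using x(2) e f by (intro is_inverse_unique[of "e \<odot> f"]) simp_all
  moreover have "?g \<odot> ?g = ?g" using e f x(1) by (simp add: smult_assoc xx')
  ultimately have idem: "x \<odot> x = x" by simp
  then have "is_inverse Q x x" "is_inverse Q x (e \<odot> f)"
    using x e f by (simp_all add: is_inverse_def smult_assoc)
  then have "x = e \<odot> f" using x(1) by (rule is_inverse_unique)
  then show ?thesis using idem x(1) by (simp add: idempotents_def)
qed

text \<open>Products of idempotents being idempotent, both \<open>e f\<close> and \<open>f e\<close>
  are inverses of \<open>e f\<close>.\<close>

lemma idempotents_commute:
  assumes "e \<in> idempotents Q" "f \<in> idempotents Q"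
  shows "e \<odot> f = f \<odot> e"
proof -
  have e: "e \<in> carrier Q" "e \<odot> e = e" and f: "f \<in> carrier Q" "f \<odot> f = f"
    using assms by (auto simp: idempotents_def)
  have ee: "e \<odot> (e \<odot> y) = e \<odot> y" and ff: "f \<odot> (f \<odot> y) = f \<odot> y" if "y \<in> carrier Q" for y
    using that e f by (simp_all add: smult_assoc[symmetric])
  have ef: "e \<odot> (f \<odot> (e \<odot> f)) = e \<odot> f" "f \<odot> (e \<odot> (f \<odot> e)) = f \<odot> e"
    using idempotents_mult_closed[OF assms] idempotents_mult_closed[OF assms(2,1)] e f
    by (simp_all add: idempotents_def smult_assoc)
  show ?thesis
  proof (rule is_inverse_unique)
    show "is_inverse Q (e \<odot> f) (e \<odot> f)" "is_inverse Q (e \<odot> f) (f \<odot> e)"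
      using e f ef by (simp_all add: is_inverse_def smult_assoc ee ff)
  qed (use e f in simp)
qed

lemma idempotents_eq:
  assumes "e \<in> idempotents Q" "f \<in> idempotents Q" "e \<odot> f \<noteq> w"
  shows "e = f"
proof -
  have e: "e \<in> carrier Q" "e \<odot> e = e" and f: "f \<in> carrier Q" "f \<odot> f = f"
    using assms by (auto simp: idempotents_def)
  note ef = idempotents_mult_closed[OF assms(1,2)]
  have comm: "e \<odot> f = f \<odot> e" using assms(1,2) by (rule idempotents_commute)
  have e1: "e \<odot> (e \<odot> f) = e \<odot> f" using e f by (simp add: smult_assoc[symmetric])
  have e2: "(e \<odot> f) \<odot> e = e \<odot> f" unfolding comm using e f by (simp add: smult_assoc)
  have f1: "f \<odot> (e \<odot> f) = e \<odot> f" unfolding comm using e f by (simp add: smult_assoc[symmetric])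
  have f2: "(e \<odot> f) \<odot> f = e \<odot> f" using e f by (simp add: smult_assoc)
  have "e \<noteq> w" "f \<noteq> w" using assms(3) e f by auto
  then have "e \<odot> f = e" "e \<odot> f = f"
    using primitive assms ef e1 e2 f1 f2 unfolding primitive_def by metis+
  then show ?thesis by simp
qed

lemma sinv_idempotents:
  assumes "a \<in> carrier Q"
  shows "sinv Q a \<odot> a \<in> idempotents Q" "a \<odot> sinv Q a \<in> idempotents Q"
  using assms by (simp_all add: idempotents_def smult_assoc)

text \<open>The nonzero element \<open>x a = y b\<close> is fixed on the right by both idempotents,
  hence by their product, which therefore cannot be zero.\<close>

lemma domain_eq_if_multiples_meet:
  assumes "a \<in> carrier Q" "b \<in> carrier Q" "x \<in> carrier Q" "y \<in> carrier Q"
    and "x \<odot> a = y \<odot> b" "x \<odot> a \<noteq> w"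
  shows "sinv Q a \<odot> a = sinv Q b \<odot> b"
proof (rule idempotents_eq)
  let ?e = "sinv Q a \<odot> a" and ?f = "sinv Q b \<odot> b"
  have "x \<odot> a = (y \<odot> b) \<odot> ?f" using assms by (simp add: smult_assoc)
  also have "\<dots> = (x \<odot> a) \<odot> ?f" using assms(5) by simp
  also have "\<dots> = (x \<odot> a) \<odot> (?e \<odot> ?f)" using assms(1-4) by (simp add: smult_assoc)
  finally have *: "x \<odot> a = (x \<odot> a) \<odot> (?e \<odot> ?f)" .
  show "?e \<odot> ?f \<noteq> w"
  proof
    assume "?e \<odot> ?f = w"
    with * assms show False by simp
  qed
qed (use assms sinv_idempotents in auto)

text \<open>Writing \<open>a b\<^sup>-\<^sup>1 = x\<^sup>-\<^sup>1 y\<close> yields the common left multiple \<open>x a = y b\<close>.\<close>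

lemma multiples_meet_if_domain_eq:
  assumes T: "T \<subseteq> carrier Q"
    and frac: "\<forall>q\<in>carrier Q. \<exists>a\<in>T. \<exists>b\<in>T. q = sinv Q a \<odot> b"
    and a: "a \<in> carrier Q" "a \<noteq> w" and b: "b \<in> carrier Q"
    and eq: "sinv Q a \<odot> a = sinv Q b \<odot> b"
  shows "\<exists>x\<in>T. \<exists>y\<in>T. x \<odot> a = y \<odot> b \<and> x \<odot> a \<noteq> w"
proof -
  define t where "t = a \<odot> sinv Q b"
  have t: "t \<in> carrier Q" "t \<odot> b = a"
    using a b by (simp_all add: t_def smult_assoc eq[symmetric])
  then have "t \<noteq> w" using a b by auto
  obtain x y where xy: "x \<in> T" "y \<in> T" "t = sinv Q x \<odot> y" using frac t(1) by blast
  then have S: "x \<in> carrier Q" "y \<in> carrier Q" using T by auto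
  let ?e = "x \<odot> sinv Q x" and ?f = "y \<odot> sinv Q y"
  \<comment> \<open>Since \<open>t\<close> is nonzero and equals \<open>x^-1 (?e ?f) y\<close>, the
    two range idempotents have nonzero product and coincide.\<close>
  have "sinv Q x \<odot> (?e \<odot> ?f) \<odot> y = t" using S by (simp add: xy(3) smult_assoc)
  then have "?e \<odot> ?f \<noteq> w" using S \<open>t \<noteq> w\<close> by (metis sinv_closed zero_simps(2,3))
  then have ef: "?e = ?f" using S by (intro idempotents_eq sinv_idempotents)
  have "x \<odot> t = ?e \<odot> y" using S by (simp add: xy(3) smult_assoc)
  then have xt: "x \<odot> t = y" unfolding ef using S by simp
  have xa: "x \<odot> a = y \<odot> b"
    using smult_assoc[of x t b] S t b xt by simp
  have "y \<noteq> w" using \<open>t \<noteq> w\<close> S xy(3) by auto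
  \<comment> \<open>Multiplying \<open>x a\<close> by \<open>b^-1\<close> returns
    \<open>x t = y\<close>, which is nonzero.\<close>
  moreover have "(x \<odot> a) \<odot> sinv Q b = y" using S a b xt by (simp add: smult_assoc t_def)
  ultimately have "x \<odot> a \<noteq> w" using b by (metis sinv_closed zero_simps(2))
  with xy xa show ?thesis by blast
qed

text \<open>A semigroup embedding is not assumed to preserve zero. Writing
  \<open>w = a^-1 b\<close>, it suffices that \<open>v a^-1 = v\<close>, since then
  \<open>v w = v b = v\<close>, while \<open>v w = w\<close>.\<close>

lemma zero_eqI:
  assumes T: "T \<subseteq> carrier Q"
    and frac: "\<forall>q\<in>carrier Q. \<exists>a\<in>T. \<exists>b\<in>T. q = sinv Q a \<odot> b"
    and v: "v \<in> T" "\<And>a. a \<in> T \<Longrightarrow> v \<odot> a = v" "\<And>a. a \<in> T \<Longrightarrow> a \<odot> v = v"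
  shows "v = w"
proof -
  have "w \<in> carrier Q" by simp
  then obtain a b where ab: "a \<in> T" "b \<in> T" "w = sinv Q a \<odot> b" using frac by blast
  have S: "v \<in> carrier Q" "a \<in> carrier Q" "b \<in> carrier Q" using T v(1) ab by auto
  have "v \<in> idempotents Q" using S v(1,2) by (simp add: idempotents_def)
  then have comm: "v \<odot> (a \<odot> sinv Q a) = (a \<odot> sinv Q a) \<odot> v"
    using S by (intro idempotents_commute sinv_idempotents)
  \<comment> \<open>The inverse lies outside \<open>T\<close> in general, so \<open>a\<close> is
    inserted first: \<open>v a^-1 = v (a a^-1)\<close>. The idempotents then commute, and the
    product collapses to \<open>a v\<close>.\<close>
  have "v \<odot> sinv Q a = v \<odot> (a \<odot> sinv Q a)"
    using S v(2)[OF ab(1)] by (simp add: smult_assoc[symmetric])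
  also have "\<dots> = (a \<odot> sinv Q a) \<odot> (a \<odot> v)" using comm v(3)[OF ab(1)] by simp
  also have "\<dots> = a \<odot> v" using S by (simp add: smult_assoc)
  also have "\<dots> = v" using v(3)[OF ab(1)] .
  finally have "v \<odot> sinv Q a = v" .
  then have "v \<odot> w = v"
    using S v(2)[OF ab(2)] unfolding ab(3) by (simp add: smult_assoc[symmetric])
  then show ?thesis using S by simp
qed

end

section \<open>I-orders and reversal\<close>

lemma is_inverse_opp:
  "sgrp Q \<Longrightarrow> a \<in> carrier Q \<Longrightarrow> is_inverse (opp Q) a b \<longleftrightarrow> is_inverse Q a b"
  by (auto simp: is_inverse_def sgrp.smult_assoc[of Q])

lemma sinv_opp: "sgrp Q \<Longrightarrow> a \<in> carrier Q \<Longrightarrow> sinv (opp Q) a = sinv Q a"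
  by (simp add: sinv_def is_inverse_opp)

lemma primitive_inverse_semigroup_opp:
  "primitive_inverse_semigroup Q \<Longrightarrow> primitive_inverse_semigroup (opp Q)"
  by (auto simp: primitive_inverse_semigroup_def inverse_semigroup_def sgrp_opp is_inverse_opp)

text \<open>Reversal keeps inverses and exchanges the forms \<open>a^-1 b\<close> and
  \<open>c d^-1\<close>, both of which are part of \<open>sub_I_order\<close>.\<close>

lemma I_order_in_opp:
  assumes "sgrp Q" "I_order_in S Q"
  shows "I_order_in (opp S) (opp Q)"
proof -
  obtain \<phi> where \<phi>: "sgrp_embedding S Q \<phi>" "sub_I_order (\<phi> ` carrier S) Q"
    using assms(2) by (auto simp: I_order_in_def)
  have "sgrp_embedding (opp S) (opp Q) \<phi>"
    using \<phi>(1) by (simp add: sgrp_embedding_def)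
  moreover have "sub_I_order (\<phi> ` carrier S) (opp Q)"
  proof -
    have T: "\<phi> ` carrier S \<subseteq> carrier Q" using \<phi>(1) by (simp add: sgrp_embedding_def)
    then have sinv: "sinv (opp Q) a = sinv Q a" if "a \<in> \<phi> ` carrier S" for a
      using that assms(1) by (intro sinv_opp) auto
    have "\<exists>a\<in>\<phi> ` carrier S. \<exists>b\<in>\<phi> ` carrier S. q = sinv (opp Q) a \<odot>\<^bsub>opp Q\<^esub> b"
      "\<exists>c\<in>\<phi> ` carrier S. \<exists>d\<in>\<phi> ` carrier S. q = c \<odot>\<^bsub>opp Q\<^esub> sinv (opp Q) d"
      if "q \<in> carrier Q" for q
    proof -
      obtain c d where "c \<in> \<phi> ` carrier S" "d \<in> \<phi> ` carrier S" "q = c \<odot>\<^bsub>Q\<^esub> sinv Q d"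
        using \<phi>(2) \<open>q \<in> carrier Q\<close> unfolding sub_I_order_def by blast
      then show "\<exists>a\<in>\<phi> ` carrier S. \<exists>b\<in>\<phi> ` carrier S. q = sinv (opp Q) a \<odot>\<^bsub>opp Q\<^esub> b"
        by (intro bexI[of _ d] bexI[of _ c]) (simp_all only: opp_simps sinv)
      obtain a b where "a \<in> \<phi> ` carrier S" "b \<in> \<phi> ` carrier S" "q = sinv Q a \<odot>\<^bsub>Q\<^esub> b"
        using \<phi>(2) \<open>q \<in> carrier Q\<close> unfolding sub_I_order_def by blast
      then show "\<exists>c\<in>\<phi> ` carrier S. \<exists>d\<in>\<phi> ` carrier S. q = c \<odot>\<^bsub>opp Q\<^esub> sinv (opp Q) d"
        by (intro bexI[of _ b] bexI[of _ a]) (simp_all only: opp_simps sinv)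
    qed
    moreover have "subsemigroup (\<phi> ` carrier S) (opp Q)"
      using \<phi>(2) unfolding sub_I_order_def subsemigroup_def opp_simps by blast
    ultimately show ?thesis unfolding sub_I_order_def opp_simps by blast
  qed
  ultimately show ?thesis unfolding I_order_in_def opp_simps by blast
qed

section \<open>Properties inherited from the inverse semigroup\<close>

locale primitive_I_order = zero_sgrp S z + Q: primitive_inverse Q w
  for S :: "'a sgrp" (structure) and z and Q :: "'q sgrp" and w +
  fixes \<phi> :: "'a \<Rightarrow> 'q"
  assumes emb: "sgrp_embedding S Q \<phi>" and I_order: "sub_I_order (\<phi> ` carrier S) Q"
begin

lemma emb_carrier [simp]: "a \<in> carrier S \<Longrightarrow> \<phi> a \<in> carrier Q"
  and emb_inj: "inj_on \<phi> (carrier S)"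
  and emb_mult: "a \<in> carrier S \<Longrightarrow> b \<in> carrier S \<Longrightarrow> \<phi> (a \<odot> b) = \<phi> a \<odot>\<^bsub>Q\<^esub> \<phi> b"
  using emb by (auto simp: sgrp_embedding_def)

lemma emb_eq [simp]: "a \<in> carrier S \<Longrightarrow> b \<in> carrier S \<Longrightarrow> \<phi> a = \<phi> b \<longleftrightarrow> a = b"
  using emb_inj by (simp add: inj_on_eq_iff)

lemma left_fractions:
  "\<forall>q\<in>carrier Q. \<exists>a\<in>\<phi> ` carrier S. \<exists>b\<in>\<phi> ` carrier S. q = sinv Q a \<odot>\<^bsub>Q\<^esub> b"
  using I_order by (simp add: sub_I_order_def)

lemma emb_zero: "\<phi> z = w"
proof (rule Q.zero_eqI[OF _ left_fractions])
  show "\<phi> ` carrier S \<subseteq> carrier Q" by auto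
  show "\<phi> z \<in> \<phi> ` carrier S" by simp
  show "\<phi> z \<odot>\<^bsub>Q\<^esub> a = \<phi> z" "a \<odot>\<^bsub>Q\<^esub> \<phi> z = \<phi> z" if "a \<in> \<phi> ` carrier S" for a
    using that by (auto simp: emb_mult[symmetric])
qed

lemma emb_eq_zero [simp]: "a \<in> carrier S \<Longrightarrow> \<phi> a = w \<longleftrightarrow> a = z"
  using emb_eq[of a z] by (simp add: emb_zero)

lemma emb_idempotents: "e \<in> idempotents S \<Longrightarrow> \<phi> e \<in> idempotents Q"
  by (auto simp: idempotents_def emb_mult[symmetric])

lemma idempotents_commute:
  assumes "e \<in> idempotents S" "f \<in> idempotents S"
  shows "e \<odot> f = f \<odot> e"
proof -
  have S: "e \<in> carrier S" "f \<in> carrier S" using assms by (auto simp: idempotents_def)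
  have "\<phi> (e \<odot> f) = \<phi> (f \<odot> e)"
    using Q.idempotents_commute[OF emb_idempotents[OF assms(1)] emb_idempotents[OF assms(2)]] S
    by (simp add: emb_mult)
  then show ?thesis using S by simp
qed

text \<open>Distinct idempotents have product \<open>w\<close> in \<open>Q\<close>, so if
  \<open>f\<close> differs from \<open>e\<close>, then \<open>f = e f\<close> is sent to
  \<open>w\<close>.\<close>

lemma primitive: "primitive S z"
  unfolding primitive_def
proof (intro ballI impI, elim conjE)
  fix e f
  assume ef: "e \<in> idempotents S" "f \<in> idempotents S" "e \<noteq> z" "e \<odot> f = f"
  have S: "e \<in> carrier S" "f \<in> carrier S" using ef by (auto simp: idempotents_def)
  show "f = z \<or> f = e"
  proof (rule disjCI)
    assume "f \<noteq> e"
    then have "\<phi> e \<odot>\<^bsub>Q\<^esub> \<phi> f = w"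
      using Q.idempotents_eq[OF emb_idempotents[OF ef(1)] emb_idempotents[OF ef(2)]] S by auto
    then show "f = z" using S ef(4) emb_mult[OF S] by simp
  qed
qed

lemma lam_iff_domain_eq:
  assumes "a \<in> carrier S" "b \<in> carrier S"
  shows "lam S z a b \<longleftrightarrow> (a = z \<and> b = z) \<or>
    (a \<noteq> z \<and> b \<noteq> z \<and> sinv Q (\<phi> a) \<odot>\<^bsub>Q\<^esub> \<phi> a = sinv Q (\<phi> b) \<odot>\<^bsub>Q\<^esub> \<phi> b)"
    (is "_ \<longleftrightarrow> _ \<or> _ \<and> _ \<and> ?E")
proof -
  have "a \<noteq> z \<and> b \<noteq> z \<and> ?E"
    if xy: "x \<in> carrier S" "y \<in> carrier S" "x \<odot> a = y \<odot> b" "x \<odot> a \<noteq> z" for x y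
  proof -
    have "\<phi> x \<odot>\<^bsub>Q\<^esub> \<phi> a = \<phi> y \<odot>\<^bsub>Q\<^esub> \<phi> b" "\<phi> x \<odot>\<^bsub>Q\<^esub> \<phi> a \<noteq> w"
      using xy assms by (simp_all add: emb_mult[symmetric])
    then have ?E using xy assms by (intro Q.domain_eq_if_multiples_meet[of _ _ "\<phi> x" "\<phi> y"]) simp_all
    moreover have "a \<noteq> z" "b \<noteq> z" using xy by auto
    ultimately show ?thesis by simp
  qed
  moreover have "\<exists>x\<in>carrier S. \<exists>y\<in>carrier S. x \<odot> a = y \<odot> b \<and> x \<odot> a \<noteq> z" if "a \<noteq> z" ?E
  proof -
    have "\<exists>x\<in>\<phi> ` carrier S. \<exists>y\<in>\<phi> ` carrier S.
        x \<odot>\<^bsub>Q\<^esub> \<phi> a = y \<odot>\<^bsub>Q\<^esub> \<phi> b \<and> x \<odot>\<^bsub>Q\<^esub> \<phi> a \<noteq> w"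
      using that assms by (intro Q.multiples_meet_if_domain_eq[OF _ left_fractions]) auto
    then obtain x y where xy: "x \<in> carrier S" "y \<in> carrier S"
      "\<phi> x \<odot>\<^bsub>Q\<^esub> \<phi> a = \<phi> y \<odot>\<^bsub>Q\<^esub> \<phi> b" "\<phi> x \<odot>\<^bsub>Q\<^esub> \<phi> a \<noteq> w"
      by blast
    then have "x \<odot> a = y \<odot> b" "x \<odot> a \<noteq> z" using assms by (simp_all add: emb_mult[symmetric])
    with xy(1,2) show ?thesis by blast
  qed
  ultimately show ?thesis unfolding lam_iff[OF zero assms] by blast
qed

lemma transp_lam: "transp_on (carrier S) (lam S z)"
  by (rule transp_onI) (auto simp: lam_iff_domain_eq)

end

section \<open>The equivalence of the three conditions\<close>

lemma primitive_I_order_obtain: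
  fixes Q :: "'q sgrp"
  assumes "zero_sgrp S z" "primitive_inverse_semigroup Q" "I_order_in S Q"
  obtains w \<phi> where "primitive_I_order S z Q w \<phi>"
proof -
  obtain \<phi> where "sgrp_embedding S Q \<phi>" "sub_I_order (\<phi> ` carrier S) Q"
    using assms(3) by (auto simp: I_order_in_def)
  moreover obtain w where "is_zero Q w" "primitive Q w"
    using assms(2) by (auto simp: primitive_inverse_semigroup_def)
  ultimately have "primitive_I_order S z Q w \<phi>"
    using assms(1,2)
    by (simp add: primitive_I_order_def primitive_I_order_axioms_def primitive_inverse_def
        primitive_inverse_axioms_def primitive_inverse_semigroup_def inverse_semigroup_def)
  then show thesis by (rule that)
qed

text \<open>Transitivity of \<open>rho\<close> is that of \<open>lam\<close> for
  \<open>opp S\<close>, an I-order in \<open>opp Q\<close>.\<close>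

lemma I_order_imp_primitive_adequate:
  fixes Q :: "'q sgrp"
  assumes S: "zero_sgrp S z" and "abundant S"
    and Q: "primitive_inverse_semigroup Q" "I_order_in S Q"
  shows "adequate S \<and> primitive S z \<and>
    transp_on (carrier S) (lam S z) \<and> transp_on (carrier S) (rho S z)"
proof -
  obtain w \<phi> where "primitive_I_order S z Q w \<phi>"
    using S Q by (rule primitive_I_order_obtain)
  then interpret I: primitive_I_order S z Q w \<phi> .
  have "sgrp Q" by (rule I.Q.sgrp_axioms)
  have "zero_sgrp (opp S) z" using S by (rule zero_sgrp.zero_sgrp_opp)
  then obtain w' \<phi>' where "primitive_I_order (opp S) z (opp Q) w' \<phi>'"
    using primitive_inverse_semigroup_opp[OF Q(1)] I_order_in_opp[OF \<open>sgrp Q\<close> Q(2)]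
    by (rule primitive_I_order_obtain)
  then interpret op: primitive_I_order "opp S" z "opp Q" w' \<phi>' .
  have "adequate S" using assms(2) I.idempotents_commute by (simp add: adequate_def)
  then show ?thesis using I.primitive I.transp_lam op.transp_lam by simp
qed

theorem lemma6p5:
  fixes S :: "'a sgrp" and z :: 'a
  assumes "sgrp S" and "is_zero S z"
  shows
    "((abundant S \<and> (\<exists>Q :: ('a \<times> 'a) sgrp. primitive_inverse_semigroup Q \<and> I_order_in S Q))
        \<longleftrightarrow> (adequate S \<and> primitive S z \<and>
             transp_on (carrier S) (lam S z) \<and> transp_on (carrier S) (rho S z)))
   \<and> ((adequate S \<and> primitive S z \<and>
             transp_on (carrier S) (lam S z) \<and> transp_on (carrier S) (rho S z))
        \<longleftrightarrow> (zero_cancellative S z \<and> categorical_at S z \<and>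
             (\<forall>a\<in>carrier S. (\<exists>e\<in>carrier S. e \<odot>\<^bsub>S\<^esub> a = a) \<and> (\<exists>f\<in>carrier S. a \<odot>\<^bsub>S\<^esub> f = a)) \<and>
             transp_on (carrier S) (lam S z) \<and> transp_on (carrier S) (rho S z)))
   \<and> ((abundant S \<and> (\<exists>Q :: 'q sgrp. primitive_inverse_semigroup Q \<and> I_order_in S Q))
        \<longrightarrow> (adequate S \<and> primitive S z \<and>
             transp_on (carrier S) (lam S z) \<and> transp_on (carrier S) (rho S z)))"
proof -
  interpret zero_sgrp S z
    by (intro zero_sgrp.intro zero_sgrp_axioms.intro assms)
  let ?tr = "transp_on (carrier S) (lam S z) \<and> transp_on (carrier S) (rho S z)"
  let ?adequate = "adequate S \<and> primitive S z \<and> ?tr"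
  let ?category = "zero_cancellative S z \<and> categorical_at S z \<and>
    (\<forall>a\<in>carrier S. (\<exists>e\<in>carrier S. e \<odot>\<^bsub>S\<^esub> a = a) \<and>
      (\<exists>f\<in>carrier S. a \<odot>\<^bsub>S\<^esub> f = a)) \<and> ?tr"
  have category: ?category if ?adequate
  proof -
    interpret primitive_adequate S z
      using that by unfold_locales simp_all
    show ?thesis
      using that by (simp add: zero_cancellative categorical_at ex_left_identity ex_right_identity)
  qed
  have zero_cat: "zero_category S z" if ?category
    using that by unfold_locales simp_all
  have adequate: ?adequate if ?category
    using zero_category.adequate[OF zero_cat[OF that]] zero_category.primitive[OF zero_cat[OF that]]
      that by simp
  have I_order: "\<exists>Q :: ('a \<times> 'a) sgrp. primitive_inverse_semigroup Q \<and> I_order_in S Q" if ?category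
  proof -
    interpret ore_zero_category S z
      using zero_cat[OF that] that by (simp add: ore_zero_category_def ore_zero_category_axioms_def)
    show ?thesis
      using primitive_inverse_semigroup_fractions I_order_fractions by (intro exI conjI)
  qed
  \<comment> \<open>This holds for \<open>Q\<close> over any type, so it serves both the type of
    pairs and \<open>'q\<close>.\<close>
  note embedded = I_order_imp_primitive_adequate[OF zero_sgrp_axioms]
  have order: "abundant S \<and> (\<exists>Q :: ('a \<times> 'a) sgrp. primitive_inverse_semigroup Q \<and> I_order_in S Q)"
    if ?adequate
    using that I_order[OF category] by (simp add: adequate_def)
  show ?thesis
  proof (rule conjI[OF iffI conjI[OF iffI impI]])
    assume "abundant S \<and> (\<exists>Q :: ('a \<times> 'a) sgrp. primitive_inverse_semigroup Q \<and> I_order_in S Q)"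
    then show ?adequate by (elim conjE exE) (rule embedded)
  next
    assume "abundant S \<and> (\<exists>Q :: 'q sgrp. primitive_inverse_semigroup Q \<and> I_order_in S Q)"
    then show ?adequate by (elim conjE exE) (rule embedded)
  qed (fact order category adequate)+
qed

end
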